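(* If a non-elementary group $G$ admits a geometric (i.e. proper and cocompact) action on a geodesic metric space $(Y,d)$ with a contracting element, then $G$ is growth tight with respect to $d$; that is, for every infinite normal subgroup $\Gamma$ of $G$, with $\bar G=G/\Gamma$, one has $\delta_G>\delta_{\bar G}$.
   Context: An infinite group is called elementary if it is a finite extension of a cyclic group. Actions are by isometries. The action is proper if $\{g\in G: d(o,go)\le n\}$ is finite for all $o\in Y$ and $n\ge 0$. Growth rates: fix $o\in Y$ and set $B(o,n)=\{go: g\in G,\ d(o,go)\le n\}$. For $A\subset G$, $\delta_A=\limsup_{n\to\infty} n^{-1}\ln \sharp(B(o,n)\cap Ao)$ (independent of $o$). For a normal subgroup $\Gamma$ of $G$, $\bar G=G/\Gamma$ acts on $\bar Y=Y/\Gamma$ by $\Gamma g\cdot \Gamma x=\Gamma gx$; equip $\bar Y$ with the quotient metric $\bar d(\Gamma x,\Gamma y)=d(\Gamma x,\Gamma y)$ (the distance between the two orbits). Then $\delta_{\bar G}$ is the growth rate of $\bar G$ for this action, relative to $\bar d$. Contracting: quasigeodesics are understood in the usual sense. Fix a small number $\delta_0>0$; for $X\subset Y$ and $y\in Y$ let $\Pi_X(y)=\{x\in X: d(y,x)\le d(y,X)+\delta_0\}$ and $\Pi_X(A)=\bigcup_{a\in A}\Pi_X(a)$. Fix a preferred collection $\mathcal L$ of quasigeodesics in $Y$ containing all geodesics. A subset $X\subset Y$ is contracting (with respect to $\mathcal L$) if there are functions $\mu,\epsilon:\mathbb R\times\mathbb R\to\mathbb R_+$ such that $\operatorname{diam}\Pi_X(q)<\epsilon(\lambda,c)$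 for every $(\lambda,c)$-quasigeodesic $q\in\mathcal L$ with $d(q,X)\ge\mu(\lambda,c)$. An element $h\in G$ is contracting if some (or any) orbit of $\langle h\rangle$ in $Y$ is contracting, i.e. $\langle h\rangle o$ is contracting for some (hence any) $o\in Y$.
   Formalization: The contracting element is required to have infinite order; read literally, the definition also admits torsion elements such as the identity, and the claim then fails (Z^2 acting on R^2 with Γ = Z×0, where both growth rates are 0). *)

theory Defs
  imports
    "HOL-Analysis.Analysis"
    "HOL-Algebra.Group_Action"
    "HOL-Algebra.Elementary_Groups"
begin

section \<open>Groups\<close>

definition elementary_group :: "('a, 'm) monoid_scheme \<Rightarrow> bool" where
  "elementary_group G \<longleftrightarrow> group G \<and> infinite (carrier G) \<and>
     (\<exists>H. subgroup H G \<and> cyclic_group (G\<lparr>carrier := H\<rparr>) \<and> finite (rcosets\<^bsub>G\<^esub> H))"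

definition nonelementary_group :: "('a, 'm) monoid_scheme \<Rightarrow> bool" where
  "nonelementary_group G \<longleftrightarrow> group G \<and> infinite (carrier G) \<and> \<not> elementary_group G"

section \<open>Geodesics and quasigeodesics\<close>

text \<open>Curves are pairs of a closed interval (bounded or not) and a map; the values of
  the map outside the interval are irrelevant.\<close>

type_synonym 'b curve = "real set \<times> (real \<Rightarrow> 'b)"

definition parameter_interval :: "real set \<Rightarrow> bool" where
  "parameter_interval I \<longleftrightarrow> is_interval I \<and> closed I \<and> I \<noteq> {}"

definition geodesic :: "'b::metric_space curve \<Rightarrow> bool" where
  "geodesic = (\<lambda>(I, p). parameter_interval I \<and>
     (\<forall>s\<in>I. \<forall>t\<in>I. dist (p s) (p t) = \<bar>s - t\<bar>))"

definition quasigeodesic :: "real \<Rightarrow> real \<Rightarrow> 'b::metric_space curve \<Rightarrow> bool" where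
  "quasigeodesic l c = (\<lambda>(I, p). 1 \<le> l \<and> 0 \<le> c \<and> parameter_interval I \<and>
     (\<forall>s\<in>I. \<forall>t\<in>I. \<bar>s - t\<bar> / l - c \<le> dist (p s) (p t) \<and>
                  dist (p s) (p t) \<le> l * \<bar>s - t\<bar> + c))"

definition curve_image :: "'b curve \<Rightarrow> 'b set" where
  "curve_image = (\<lambda>(I, p). p ` I)"

definition geodesic_space :: "'b::metric_space itself \<Rightarrow> bool" where
  "geodesic_space _ \<longleftrightarrow>
     (\<forall>x y :: 'b. \<exists>p. geodesic ({0..dist x y}, p) \<and> p 0 = x \<and> p (dist x y) = y)"

definition preferred_collection :: "'b::metric_space curve set \<Rightarrow> bool" where
  "preferred_collection L \<longleftrightarrow>
     (\<forall>q\<in>L. \<exists>l c. quasigeodesic l c q) \<and> {q. geodesic q} \<subseteq> L"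

section \<open>Contracting subsets\<close>

definition point_proj :: "real \<Rightarrow> 'b::metric_space set \<Rightarrow> 'b \<Rightarrow> 'b set" where
  "point_proj \<delta>0 X y = {x \<in> X. dist y x \<le> infdist y X + \<delta>0}"

definition set_proj :: "real \<Rightarrow> 'b::metric_space set \<Rightarrow> 'b set \<Rightarrow> 'b set" where
  "set_proj \<delta>0 X A = (\<Union>a\<in>A. point_proj \<delta>0 X a)"

text \<open>Boundedness is stated separately because the real-valued \<^const>\<open>diameter\<close> is
  meaningful on bounded sets only.\<close>

definition contracting_set ::
  "real \<Rightarrow> 'b::metric_space curve set \<Rightarrow> 'b set \<Rightarrow> bool" where
  "contracting_set \<delta>0 L X \<longleftrightarrow>
     (\<exists>\<mu> \<epsilon> :: real \<Rightarrow> real \<Rightarrow> real.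
        (\<forall>l c. 0 \<le> \<mu> l c \<and> 0 \<le> \<epsilon> l c) \<and>
        (\<forall>l c. \<forall>q\<in>L. quasigeodesic l c q \<and> \<mu> l c \<le> setdist (curve_image q) X \<longrightarrow>
           bounded (set_proj \<delta>0 X (curve_image q)) \<and>
           diameter (set_proj \<delta>0 X (curve_image q)) < \<epsilon> l c))"

section \<open>Actions\<close>

definition isometric_action ::
  "('a, 'm) monoid_scheme \<Rightarrow> ('a \<Rightarrow> 'b::metric_space \<Rightarrow> 'b) \<Rightarrow> bool" where
  "isometric_action G \<phi> \<longleftrightarrow> group_action G UNIV \<phi> \<and>
     (\<forall>g\<in>carrier G. \<forall>x y. dist (\<phi> g x) (\<phi> g y) = dist x y)"

definition proper_action ::
  "('a, 'm) monoid_scheme \<Rightarrow> ('a \<Rightarrow> 'b::metric_space \<Rightarrow> 'b) \<Rightarrow> bool" where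
  "proper_action G \<phi> \<longleftrightarrow>
     (\<forall>y. \<forall>n::real. 0 \<le> n \<longrightarrow> finite {g \<in> carrier G. dist y (\<phi> g y) \<le> n})"

definition cocompact_action ::
  "('a, 'm) monoid_scheme \<Rightarrow> ('a \<Rightarrow> 'b::metric_space \<Rightarrow> 'b) \<Rightarrow> bool" where
  "cocompact_action G \<phi> \<longleftrightarrow> (\<exists>K. compact K \<and> (\<Union>g\<in>carrier G. \<phi> g ` K) = UNIV)"

definition geometric_action ::
  "('a, 'm) monoid_scheme \<Rightarrow> ('a \<Rightarrow> 'b::metric_space \<Rightarrow> 'b) \<Rightarrow> bool" where
  "geometric_action G \<phi> \<longleftrightarrow>
     isometric_action G \<phi> \<and> proper_action G \<phi> \<and> cocompact_action G \<phi>"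

text \<open>A contracting element has infinite order, as is usual: a torsion element has bounded
  orbits, which are contracting for trivial reasons, so without this clause the identity
  would be a contracting element of every group.\<close>

definition contracting_element ::
  "real \<Rightarrow> 'b::metric_space curve set \<Rightarrow> ('a, 'm) monoid_scheme \<Rightarrow>
   ('a \<Rightarrow> 'b \<Rightarrow> 'b) \<Rightarrow> 'a \<Rightarrow> bool" where
  "contracting_element \<delta>0 L G \<phi> h \<longleftrightarrow>
     h \<in> carrier G \<and> infinite (generate G {h}) \<and>
     (\<exists>y. contracting_set \<delta>0 L (orbit (G\<lparr>carrier := generate G {h}\<rparr>) \<phi> y))"

section \<open>Growth rates\<close>

text \<open>The distance is a parameter, so that the same definition applies to the action of
  a quotient group on the space of orbits.\<close>

definition orbit_ball ::
  "('a, 'm) monoid_scheme \<Rightarrow> ('a \<Rightarrow> 'c \<Rightarrow> 'c) \<Rightarrow> ('c \<Rightarrow> 'c \<Rightarrow> real) \<Rightarrow> 'c \<Rightarrow> nat \<Rightarrow> 'c set" where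
  "orbit_ball G \<phi> d y n = {\<phi> g y | g. g \<in> carrier G \<and> d y (\<phi> g y) \<le> real n}"

definition growth_rate ::
  "('a, 'm) monoid_scheme \<Rightarrow> ('a \<Rightarrow> 'c \<Rightarrow> 'c) \<Rightarrow> ('c \<Rightarrow> 'c \<Rightarrow> real) \<Rightarrow> 'c \<Rightarrow> 'a set \<Rightarrow> ereal" where
  "growth_rate G \<phi> d y A =
     limsup (\<lambda>n. ereal (ln (real (card (orbit_ball G \<phi> d y n \<inter> (\<lambda>g. \<phi> g y) ` A))) / real n))"

text \<open>The action of \<open>G/\<Gamma>\<close> on the \<open>\<Gamma>\<close>-orbits, given as the product of a coset and an
  orbit as sets; the following lemma shows that \<open>\<Gamma>g \<cdot> \<Gamma>x = \<Gamma>gx\<close>.\<close>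

definition quotient_action :: "('a \<Rightarrow> 'b \<Rightarrow> 'b) \<Rightarrow> 'a set \<Rightarrow> 'b set \<Rightarrow> 'b set" where
  "quotient_action \<phi> C A = {\<phi> g x | g x. g \<in> C \<and> x \<in> A}"

lemma quotient_action_orbit:
  assumes "group_action G E \<phi>" and N: "\<Gamma> \<lhd> G" and g: "g \<in> carrier G" and x: "x \<in> E"
  shows "quotient_action \<phi> (\<Gamma> #>\<^bsub>G\<^esub> g) (orbit (G\<lparr>carrier := \<Gamma>\<rparr>) \<phi> x)
       = orbit (G\<lparr>carrier := \<Gamma>\<rparr>) \<phi> (\<phi> g x)"
proof -
  interpret group_action G E \<phi> by fact
  interpret group G using group_hom group_hom.axioms(1) by blast
  interpret N: normal \<Gamma> G by fact
  have comp: "\<phi> a (\<phi> b x) = \<phi> (a \<otimes>\<^bsub>G\<^esub> b) x" if "a \<in> carrier G" "b \<in> carrier G" for a b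
    using composition_rule[OF x that] by simp
  show ?thesis
  proof (intro equalityI subsetI)
    fix z assume "z \<in> quotient_action \<phi> (\<Gamma> #>\<^bsub>G\<^esub> g) (orbit (G\<lparr>carrier := \<Gamma>\<rparr>) \<phi> x)"
    then obtain a b where ab: "a \<in> \<Gamma>" "b \<in> \<Gamma>" and z: "z = \<phi> (a \<otimes>\<^bsub>G\<^esub> g) (\<phi> b x)"
      unfolding quotient_action_def orbit_def r_coset_def by auto
    have c: "a \<in> carrier G" "b \<in> carrier G" using ab N.subset by auto
    have n: "g \<otimes>\<^bsub>G\<^esub> b \<otimes>\<^bsub>G\<^esub> inv\<^bsub>G\<^esub> g \<in> \<Gamma>"
      using N.inv_op_closed2[OF g ab(2)] .
    have "(a \<otimes>\<^bsub>G\<^esub> (g \<otimes>\<^bsub>G\<^esub> b \<otimes>\<^bsub>G\<^esub> inv\<^bsub>G\<^esub> g)) \<otimes>\<^bsub>G\<^esub> g = (a \<otimes>\<^bsub>G\<^esub> g) \<otimes>\<^bsub>G\<^esub> b"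
      using c g by (simp add: m_assoc)
    then have "z = \<phi> (a \<otimes>\<^bsub>G\<^esub> (g \<otimes>\<^bsub>G\<^esub> b \<otimes>\<^bsub>G\<^esub> inv\<^bsub>G\<^esub> g)) (\<phi> g x)"
      using z c g by (simp add: comp)
    then show "z \<in> orbit (G\<lparr>carrier := \<Gamma>\<rparr>) \<phi> (\<phi> g x)"
      using N.m_closed[OF ab(1) n] unfolding orbit_def by auto
  next
    fix z assume "z \<in> orbit (G\<lparr>carrier := \<Gamma>\<rparr>) \<phi> (\<phi> g x)"
    then obtain a where a: "a \<in> \<Gamma>" and z: "z = \<phi> a (\<phi> g x)"
      unfolding orbit_def by auto
    have "z = \<phi> (a \<otimes>\<^bsub>G\<^esub> g) (\<phi> \<one>\<^bsub>G\<^esub> x)"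
      using z a g N.subset by (simp add: comp subsetD)
    then show "z \<in> quotient_action \<phi> (\<Gamma> #>\<^bsub>G\<^esub> g) (orbit (G\<lparr>carrier := \<Gamma>\<rparr>) \<phi> x)"
    proof -
      have "a \<otimes>\<^bsub>G\<^esub> g \<in> \<Gamma> #>\<^bsub>G\<^esub> g"
        using a unfolding r_coset_def by blast
      moreover have "\<phi> \<one>\<^bsub>G\<^esub> x \<in> orbit (G\<lparr>carrier := \<Gamma>\<rparr>) \<phi> x"
        using N.one_closed unfolding orbit_def by auto
      ultimately show ?thesis
        unfolding quotient_action_def \<open>z = \<phi> (a \<otimes>\<^bsub>G\<^esub> g) (\<phi> \<one>\<^bsub>G\<^esub> x)\<close> by blast
    qed
  qed
qed

text \<open>The quotient metric on orbits is \<^const>\<open>setdist\<close>. The rates do not depend on the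
  base point.\<close>

definition growth_tight ::
  "('a, 'm) monoid_scheme \<Rightarrow> ('a \<Rightarrow> 'b::metric_space \<Rightarrow> 'b) \<Rightarrow> 'b \<Rightarrow> bool" where
  "growth_tight G \<phi> y \<longleftrightarrow>
     (\<forall>\<Gamma>. \<Gamma> \<lhd> G \<and> infinite \<Gamma> \<longrightarrow>
        growth_rate G \<phi> dist y (carrier G) >
        growth_rate (G Mod \<Gamma>) (quotient_action \<phi>) setdist
          (orbit (G\<lparr>carrier := \<Gamma>\<rparr>) \<phi> y) (carrier (G Mod \<Gamma>)))"

end

theory Submission
  imports Defs
begin

text \<open>Let \<open>\<ell>(g) = d(o, go)\<close>. The nearest-point projection to \<open>\<langle>h\<rangle>o\<close> satisfies two inequalities: it is
  almost nearest, and \<open>d(y, \<pi> y) + d(\<pi> y, \<pi> z) + d(\<pi> z, z) \<le> d(y, z) + K\<close> as soon as \<open>d(\<pi> y, \<pi> z) > K\<close>.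
  Everything else happens in the group. They give the elementary closure \<open>E\<close> of \<open>h\<close> (the commensurator of
  \<open>\<langle>h\<rangle>\<close>, a finite extension of \<open>\<langle>h\<rangle>\<close>) and Behrstock's inequality for \<open>\<langle>h\<rangle>\<close> and \<open>g\<langle>h\<rangle>\<close>, \<open>g \<notin> E\<close>.

  An infinite normal subgroup \<open>\<Gamma>\<close> contains some \<open>\<gamma> \<notin> E\<close>, and \<open>f = h\<^sup>n \<gamma> h\<^sup>-\<^sup>n \<in> \<Gamma>\<close>. Conjugate the shortest
  representatives of the cosets of \<open>\<Gamma>\<close> by one of three elements so that their projections to \<open>\<langle>h\<rangle>\<close> in both
  directions stay near \<open>1\<close>, and pass to a separated subset \<open>B\<close>. Then the words \<open>b\<^sub>1 f b\<^sub>2 f \<cdots> b\<^sub>k f\<close> are distinct: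
  their geodesics pass near \<open>b\<^sub>1\<close> and \<open>b\<^sub>1 f\<close>, and if those of two equal words did so at different places, then the
  longer first letter would itself run along \<open>b\<^sub>1 f\<close>, and could be shortened within its coset by removing \<open>f\<close>.

  The coset counting function is submultiplicative by cocompactness, so the sum of \<open>exp (- \<sigma> \<ell>)\<close> over the cosets diverges at the
  growth rate \<open>\<sigma>\<close> of \<open>G/\<Gamma>\<close> if \<open>\<sigma> > 0\<close>. Hence a finite \<open>B\<close> has \<open>\<Sum>b\<in>B. exp (- \<sigma> \<ell>(b f)) > 1\<close>, which forces \<open>G\<close> to grow faster than
  \<open>\<sigma>\<close>. If \<open>\<sigma> = 0\<close>, the free words in \<open>h\<^sup>n \<gamma>\<close> and \<open>h\<^sup>2\<^sup>n \<gamma>\<close> suffice.\<close>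

section \<open>Groups with a contracting cyclic subgroup\<close>

text \<open>\<open>pt\<close> is the orbit map; it need not be injective, so it induces only a
  pseudometric on the group. \<open>between\<close> is geodesicity up to an error \<open>R\<close>
  that comes from cocompactness. \<open>pr\<close> projects to the powers of \<open>h\<close> inside
  the group and is nearest only up to \<open>K\<close>.\<close>

locale contracting_group = group G for G (structure) +
  fixes pt :: "'a \<Rightarrow> 'b::metric_space" and h :: 'a and pr :: "'a \<Rightarrow> 'a" and K R :: real
  assumes left_inv: "\<lbrakk>a \<in> carrier G; b \<in> carrier G; c \<in> carrier G\<rbrakk> \<Longrightarrow>
      dist (pt (c \<otimes> a)) (pt (c \<otimes> b)) = dist (pt a) (pt b)"
    and finite_ball: "finite {g \<in> carrier G. dist (pt \<one>) (pt g) \<le> r}"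
    and between: "\<lbrakk>a \<in> carrier G; b \<in> carrier G; 0 \<le> t; t \<le> dist (pt a) (pt b)\<rbrakk> \<Longrightarrow>
      \<exists>c\<in>carrier G. dist (pt a) (pt c) \<le> t + R \<and> dist (pt c) (pt b) \<le> dist (pt a) (pt b) - t + R"
    and h_closed [simp]: "h \<in> carrier G"
    and h_inf: "h [^] (i::int) = \<one> \<Longrightarrow> i = 0"
    and pr_pow: "g \<in> carrier G \<Longrightarrow> \<exists>i::int. pr g = h [^] i"
    and pr_near: "g \<in> carrier G \<Longrightarrow> dist (pt g) (pt (pr g)) \<le> dist (pt g) (pt (h [^] (i::int))) + K"
    and pr_contract: "\<lbrakk>g \<in> carrier G; k \<in> carrier G; K < dist (pt (pr g)) (pt (pr k))\<rbrakk> \<Longrightarrow>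
      dist (pt g) (pt (pr g)) + dist (pt (pr g)) (pt (pr k)) + dist (pt (pr k)) (pt k)
        \<le> dist (pt g) (pt k) + K"
begin

abbreviation d :: "'a \<Rightarrow> 'a \<Rightarrow> real" where "d a b \<equiv> dist (pt a) (pt b)"
abbreviation H :: "int \<Rightarrow> 'a" where "H i \<equiv> h [^] i"

section \<open>Lengths, powers of \<open>h\<close> and balls\<close>

lemma H_add: "H (i + j) = H i \<otimes> H j"
  by (simp add: int_pow_mult)

lemma H_neg: "H (- i) = inv (H i)"
  by (simp add: int_pow_neg)

lemma H_inj: "H i = H j \<longleftrightarrow> i = j"
proof
  assume e: "H i = H j"
  have "H (i - j) = \<one>"
    using e H_add[of i "-j"] H_neg[of j] by simp
  then show "i = j" using h_inf[of "i - j"] by simp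
qed simp

lemma H_mult_pow: "H i [^] (j::int) = H (i * j)"
  by (simp add: int_pow_pow)

lemma pr_closed [simp]: "g \<in> carrier G \<Longrightarrow> pr g \<in> carrier G"
  using pr_pow[of g] by auto

lemma d_inv: "\<lbrakk>a \<in> carrier G; b \<in> carrier G; c \<in> carrier G\<rbrakk> \<Longrightarrow> d (inv c \<otimes> a) b = d a (c \<otimes> b)"
  using left_inv[of "inv c \<otimes> a" b c] by (simp add: m_assoc[symmetric])

lemma d_inv_one: "a \<in> carrier G \<Longrightarrow> d \<one> (inv a) = d \<one> a"
  using left_inv[of \<one> "inv a" a] by (simp add: dist_commute)

lemma d_one_mult: "\<lbrakk>a \<in> carrier G; b \<in> carrier G\<rbrakk> \<Longrightarrow> d \<one> (a \<otimes> b) \<le> d \<one> a + d \<one> b"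
  using left_inv[of \<one> b a] dist_triangle[of "pt \<one>" "pt (a \<otimes> b)" "pt a"] by simp

lemma d_right: "\<lbrakk>a \<in> carrier G; b \<in> carrier G\<rbrakk> \<Longrightarrow> d a (a \<otimes> b) = d \<one> b"
  using left_inv[of \<one> b a] by simp

lemma d_H: "d (H i) (H j) = d \<one> (H (j - i))"
  using left_inv[of \<one> "H (j - i)" "H i"] H_add[of i "j - i"] by simp

lemma K_nonneg: "0 \<le> K"
proof -
  obtain i :: int where "pr \<one> = H i" using pr_pow[of \<one>] by auto
  then show ?thesis using pr_near[of \<one> i] by simp
qed

lemma finite_ball_at:
  assumes "a \<in> carrier G" shows "finite {g \<in> carrier G. d a g \<le> r}"
proof -
  have "{g \<in> carrier G. d a g \<le> r} \<subseteq> (\<otimes>) a ` {g \<in> carrier G. d \<one> g \<le> r}"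
  proof
    fix g assume g: "g \<in> {g \<in> carrier G. d a g \<le> r}"
    have "g = a \<otimes> (inv a \<otimes> g)" using g assms by (simp add: m_assoc[symmetric])
    moreover have "d \<one> (inv a \<otimes> g) \<le> r" using d_inv[of g \<one> a] g assms by (simp add: dist_commute)
    ultimately show "g \<in> (\<otimes>) a ` {g \<in> carrier G. d \<one> g \<le> r}" using g assms by blast
  qed
  then show ?thesis using finite_ball finite_subset by blast
qed

lemma card_ball_at:
  assumes "a \<in> carrier G"
  shows "card {g \<in> carrier G. d a g \<le> r} \<le> card {g \<in> carrier G. d \<one> g \<le> r}"
proof (rule card_inj_on_le[OF _ _ finite_ball])
  show "inj_on ((\<otimes>) (inv a)) {g \<in> carrier G. d a g \<le> r}"
    using assms by (auto simp: inj_on_def)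
  show "(\<otimes>) (inv a) ` {g \<in> carrier G. d a g \<le> r} \<subseteq> {g \<in> carrier G. d \<one> g \<le> r}"
    using assms d_inv[of _ \<one> a] by (auto simp: dist_commute)
qed

text \<open>The powers of \<open>h\<close> are distinct and balls are finite, so only finitely many
  powers are short.\<close>

lemma H_far: "\<exists>n>0. \<forall>m::int. n \<le> \<bar>m\<bar> \<longrightarrow> L < d \<one> (H m)"
proof -
  have "finite (H -` {g \<in> carrier G. d \<one> g \<le> L})"
    by (rule finite_vimageI[OF finite_ball]) (simp add: inj_def H_inj)
  then obtain N where N: "\<And>m. m \<in> abs ` (H -` {g \<in> carrier G. d \<one> g \<le> L}) \<Longrightarrow> m \<le> N"
    by (meson finite_imageI bdd_above_finite bdd_above.E)
  show ?thesis
  proof (intro exI conjI allI impI)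
    show "0 < max N 0 + 1" by simp
    fix m assume "max N 0 + 1 \<le> \<bar>m\<bar>"
    then show "L < d \<one> (H m)" using N[of "\<bar>m\<bar>"] by force
  qed
qed

text \<open>A path from \<open>g\<close> to a power of \<open>h\<close> may as well go through
  \<open>pr g\<close>. If \<open>pr g\<close> and \<open>pr (H i)\<close> are far apart, contraction
  applies to \<open>g\<close> and \<open>H i\<close>; otherwise \<open>H i\<close> is itself near
  \<open>pr g\<close>, and near-minimality suffices.\<close>

lemma pr_gate:
  assumes "g \<in> carrier G"
  shows "d g (pr g) + d (pr g) (H i) \<le> d g (H i) + 3 * K"
proof -
  have 1: "d (H i) (pr (H i)) \<le> K" using pr_near[of "H i" i] by simp
  note 2 = pr_near[OF assms, of i] and K = K_nonneg
  show ?thesis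
  proof (cases "K < d (pr g) (pr (H i))")
    case True
    then show ?thesis using pr_contract[OF assms _ True] 1 K
        dist_triangle[of "pt (pr g)" "pt (H i)" "pt (pr (H i))"] zero_le_dist[of "pt (pr (H i))" "pt (H i)"]
      by (simp add: dist_commute)
  next
    case False
    then show ?thesis using 1 2 dist_triangle[of "pt (pr g)" "pt (H i)" "pt (pr (H i))"]
      by (simp add: dist_commute)
  qed
qed

lemma pr_lipschitz:
  assumes "a \<in> carrier G" "b \<in> carrier G"
  shows "d (pr a) (pr b) \<le> d a b + K"
proof (cases "K < d (pr a) (pr b)")
  case True
  then show ?thesis using pr_contract[OF assms True]
      zero_le_dist[of "pt a" "pt (pr a)"] zero_le_dist[of "pt (pr b)" "pt b"] by linarith
qed (use zero_le_dist[of "pt a" "pt b"] in linarith)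

text \<open>The choice of \<open>pr\<close> need not be equivariant. Translated back by
  \<open>H n\<close>, the power \<open>pr (H n \<otimes> g)\<close> is almost nearest to
  \<open>g\<close>, and the gate inequality keeps every such power close to
  \<open>pr g\<close>.\<close>

lemma pr_shift:
  assumes "g \<in> carrier G"
  shows "d (pr (H n \<otimes> g)) (H n \<otimes> pr g) \<le> 4 * K"
proof -
  obtain i :: int where i: "pr (H n \<otimes> g) = H i" using pr_pow[of "H n \<otimes> g"] assms by auto
  obtain j :: int where j: "pr g = H j" using pr_pow[of g] assms by auto
  have s: "H i = H n \<otimes> H (i - n)" using H_add[of n "i - n"] by simp
  have "d (H n \<otimes> g) (H n \<otimes> H (i - n)) \<le> d (H n \<otimes> g) (H (n + j)) + K"
    using pr_near[of "H n \<otimes> g" "n + j"] assms by (simp add: i s[symmetric])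
  then have "d g (H (i - n)) \<le> d g (pr g) + K"
    using assms by (simp add: H_add left_inv j)
  moreover have "d (H i) (H n \<otimes> pr g) = d (H (i - n)) (pr g)"
    using assms by (simp add: s left_inv)
  ultimately show ?thesis
    using pr_gate[OF assms, of "i - n"] by (simp add: i dist_commute)
qed

text \<open>The gate inequality for the translate \<open>g\<langle>h\<rangle>\<close>, whose
  projection is \<open>g \<otimes> pr (inv g \<otimes> c)\<close>.\<close>

lemma pr_gate_translate:
  assumes "g \<in> carrier G" "c \<in> carrier G"
  obtains v :: int where "pr (inv g \<otimes> c) = H v"
    "\<And>i. d c (g \<otimes> H v) + d (g \<otimes> H v) (g \<otimes> H i) \<le> d c (g \<otimes> H i) + 3 * K"
proof -
  obtain v :: int where v: "pr (inv g \<otimes> c) = H v" using pr_pow[of "inv g \<otimes> c"] assms by auto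
  show ?thesis
  proof (rule that[OF v])
    fix i
    show "d c (g \<otimes> H v) + d (g \<otimes> H v) (g \<otimes> H i) \<le> d c (g \<otimes> H i) + 3 * K"
      using pr_gate[of "inv g \<otimes> c" i] assms by (simp add: v d_inv left_inv)
  qed
qed

text \<open>Contraction with the projections replaced by known points near them. Each replacement
  affects two of the three distances, hence the factors 2.\<close>

lemma pass:
  assumes "a \<in> carrier G" "b \<in> carrier G" "K < d (pr a) (pr b)"
    and "d (pr a) x \<le> D1" "d (pr b) y \<le> D2"
  shows "d a x + d x y + d y b \<le> d a b + K + 2 * D1 + 2 * D2"
  using pr_contract[OF assms(1-3)] assms(4,5)
    dist_triangle[of "pt a" "pt x" "pt (pr a)"] dist_triangle[of "pt x" "pt y" "pt (pr a)"]
    dist_triangle[of "pt (pr a)" "pt y" "pt (pr b)"] dist_triangle[of "pt y" "pt b" "pt (pr b)"]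
  by (simp add: dist_commute)

section \<open>The elementary closure of the contracting element\<close>

text \<open>The relation says, without inverses, that the conjugate of
  \<open>\<langle>h\<rangle>\<close> by \<open>g\<close> meets \<open>\<langle>h\<rangle>\<close>
  nontrivially; for infinite cyclic groups this is commensurability.\<close>

definition E :: "'a set" where
  "E = {g \<in> carrier G. \<exists>p q :: int. p \<noteq> 0 \<and> q \<noteq> 0 \<and> g \<otimes> H p = H q \<otimes> g}"

lemma E_carrier: "g \<in> E \<Longrightarrow> g \<in> carrier G"
  by (simp add: E_def)

lemma conj_pow:
  assumes "g \<in> carrier G" "g \<otimes> H p = H q \<otimes> g"
  shows "g \<otimes> H (p * k) = H (q * k) \<otimes> g"
proof -
  have n: "g \<otimes> H (p * int n) = H (q * int n) \<otimes> g" for n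
  proof (induction n)
    case (Suc n)
    have S: "r * int (Suc n) = r * int n + r" for r by (simp add: ring_distribs)
    have "g \<otimes> H (p * int (Suc n)) = (g \<otimes> H (p * int n)) \<otimes> H p"
      using assms(1) unfolding S H_add by (simp add: m_assoc)
    also have "\<dots> = H (q * int n) \<otimes> (g \<otimes> H p)" using Suc assms(1) by (simp add: m_assoc)
    also have "\<dots> = H (q * int n + q) \<otimes> g" using assms by (simp add: H_add m_assoc)
    finally show ?case by (simp add: ring_distribs add.commute)
  qed (use assms in simp)
  show ?thesis
  proof (cases k rule: int_cases2)
    case (nonneg n)
    then show ?thesis using n by simp
  next
    case (nonpos n)
    have "H (q * k) \<otimes> (g \<otimes> H (p * int n)) \<otimes> H (p * k)
        = H (q * k) \<otimes> (H (q * int n) \<otimes> g) \<otimes> H (p * k)" using n by simp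
    moreover have "H (q * k) \<otimes> (g \<otimes> H (p * int n)) \<otimes> H (p * k)
        = H (q * k) \<otimes> g \<otimes> H (p * int n + p * k)"
      using assms(1) by (simp only: H_add) (simp add: m_assoc)
    moreover have "H (q * k) \<otimes> (H (q * int n) \<otimes> g) \<otimes> H (p * k)
        = H (q * k + q * int n) \<otimes> g \<otimes> H (p * k)"
      using assms(1) by (simp only: H_add) (simp add: m_assoc)
    ultimately show ?thesis using nonpos assms(1) by simp
  qed
qed

lemma E_subgroup: "subgroup E G"
proof
  show "E \<subseteq> carrier G" by (auto simp: E_def)
  show "\<one> \<in> E" by (auto simp: E_def intro!: exI[of _ 1])
next
  fix x y assume x: "x \<in> E" and y: "y \<in> E"
  obtain p q where p: "p \<noteq> 0" "q \<noteq> 0" "x \<otimes> H p = H q \<otimes> x" and xc: "x \<in> carrier G"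
    using x by (auto simp: E_def)
  obtain p' q' where p': "p' \<noteq> 0" "q' \<noteq> 0" "y \<otimes> H p' = H q' \<otimes> y" and yc: "y \<in> carrier G"
    using y by (auto simp: E_def)
  have "x \<otimes> y \<otimes> H (p' * p) = x \<otimes> (H (q' * p) \<otimes> y)"
    using conj_pow[OF yc p'(3), of p] xc yc by (simp add: m_assoc)
  also have "\<dots> = x \<otimes> H (p * q') \<otimes> y" using xc yc by (simp add: m_assoc mult.commute)
  also have "\<dots> = H (q * q') \<otimes> (x \<otimes> y)"
    using conj_pow[OF xc p(3), of q'] xc yc by (simp add: m_assoc)
  finally show "x \<otimes> y \<in> E" using p p' xc yc unfolding E_def
    by (intro CollectI conjI exI[of _ "p' * p"] exI[of _ "q * q'"]) auto
next
  fix x assume x: "x \<in> E"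
  obtain p q where p: "p \<noteq> 0" "q \<noteq> 0" "x \<otimes> H p = H q \<otimes> x" and xc: "x \<in> carrier G"
    using x by (auto simp: E_def)
  have "inv x \<otimes> H q = inv x \<otimes> (H q \<otimes> x) \<otimes> inv x" using xc by (simp add: m_assoc)
  also have "\<dots> = H p \<otimes> inv x" using xc p(3)[symmetric] by (simp add: m_assoc[symmetric])
  finally show "inv x \<in> E" using p xc unfolding E_def by auto
qed

lemma R_nonneg: "0 \<le> R"
  using between[of \<one> \<one> 0] by (auto intro: order_trans[OF zero_le_dist])

text \<open>Take \<open>c\<close> at distance \<open>t\<close> along a path from \<open>H a\<close>
  to \<open>H b\<close>. The gates at both ends put it near \<open>\<langle>h\<rangle>\<close>. By
  contraction a shortest path from \<open>g \<otimes> H i\<close> to \<open>g \<otimes> H j\<close>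
  runs near \<open>H a\<close> and \<open>H b\<close>, so \<open>c\<close> is almost between these
  two points as well, and the gates of \<open>g\<langle>h\<rangle>\<close> put it near that set
  too.\<close>

lemma coincidence:
  assumes g: "g \<in> carrier G" and a: "pr (g \<otimes> H i) = H a" and b: "pr (g \<otimes> H j) = H b"
    and far: "K < d (H a) (H b)" and t: "0 \<le> t" "t \<le> d (H a) (H b)"
  shows "\<exists>u v. d (H u) (g \<otimes> H v) \<le> 2 * R + 7 * K \<and> \<bar>d (H a) (H u) - t\<bar> \<le> R + 3 * K"
proof -
  obtain c where c: "c \<in> carrier G" "d (H a) c \<le> t + R" "d c (H b) \<le> d (H a) (H b) - t + R"
    using between[of "H a" "H b" t] t by auto
  obtain u :: int where u: "pr c = H u" using pr_pow c(1) by auto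
  note ua = pr_gate[OF c(1), of a, unfolded u] and ub = pr_gate[OF c(1), of b, unfolded u]
  have cu: "d c (H u) \<le> R + 3 * K"
    using ua ub c(2,3) dist_triangle[of "pt (H a)" "pt (H b)" "pt (H u)"] by (simp add: dist_commute)
  obtain v where v: "\<And>i. d c (g \<otimes> H v) + d (g \<otimes> H v) (g \<otimes> H i) \<le> d c (g \<otimes> H i) + 3 * K"
    using pr_gate_translate[OF g c(1)] by blast
  have "d (g \<otimes> H i) (H a) + d (H a) (H b) + d (H b) (g \<otimes> H j) \<le> d (g \<otimes> H i) (g \<otimes> H j) + K"
    using pr_contract[of "g \<otimes> H i" "g \<otimes> H j"] g far by (simp add: a b)
  then have cv: "d c (g \<otimes> H v) \<le> R + 4 * K"
    using v[of i] v[of j] c(2,3) K_nonneg dist_triangle[of "pt (g \<otimes> H i)" "pt (g \<otimes> H j)" "pt (g \<otimes> H v)"]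
      dist_triangle[of "pt c" "pt (g \<otimes> H i)" "pt (H a)"] dist_triangle[of "pt c" "pt (g \<otimes> H j)" "pt (H b)"]
    by (simp add: dist_commute)
  have "d (H u) (g \<otimes> H v) \<le> 2 * R + 7 * K"
    using cu cv dist_triangle[of "pt (H u)" "pt (g \<otimes> H v)" "pt c"] by (simp add: dist_commute)
  moreover have "\<bar>d (H a) (H u) - t\<bar> \<le> R + 3 * K"
    using ua ub c(2,3) zero_le_dist[of "pt c" "pt (H u)"] dist_triangle[of "pt (H a)" "pt (H b)" "pt (H u)"]
      dist_commute[of "pt (H u)"] dist_commute[of "pt c"] unfolding abs_le_iff by (smt (verit))
  ultimately show ?thesis by blast
qed

text \<open>Along a long overlap of \<open>\<langle>h\<rangle>\<close> and \<open>g\<langle>h\<rangle>\<close> the pigeonhole principle finds two equal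
  elements \<open>h\<^sup>-\<^sup>u g h\<^sup>v\<close> in a finite ball.\<close>

lemma overlap_in_E:
  "\<exists>D\<ge>0. \<forall>g i j. g \<in> carrier G \<longrightarrow> D < d (pr (g \<otimes> H i)) (pr (g \<otimes> H j)) \<longrightarrow>
     g \<in> E \<and> (\<exists>u v. d \<one> (inv (H u) \<otimes> g \<otimes> H v) \<le> 2 * R + 7 * K)"
proof -
  define B where "B = {g \<in> carrier G. d \<one> g \<le> 2 * R + 7 * K}"
  \<comment> \<open>The spacing exceeds twice the error in \<open>coincidence\<close>, so different
    marks give different exponents \<open>u\<close>.\<close>
  define S where "S = 2 * (R + 3 * K) + 1"
  have S: "0 < S" using K_nonneg R_nonneg by (simp add: S_def)
  have B: "finite B" unfolding B_def by (rule finite_ball)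
  show ?thesis
  proof (intro exI[of _ "real (card B) * S + K"] conjI allI impI)
    show "0 \<le> real (card B) * S + K" using S K_nonneg by simp
    fix g i j assume g: "g \<in> carrier G" and far: "real (card B) * S + K < d (pr (g \<otimes> H i)) (pr (g \<otimes> H j))"
    obtain a :: int where a: "pr (g \<otimes> H i) = H a" using pr_pow[of "g \<otimes> H i"] g by auto
    obtain b :: int where b: "pr (g \<otimes> H j) = H b" using pr_pow[of "g \<otimes> H j"] g by auto
    \<comment> \<open>Along the stretch from \<open>H a\<close> to \<open>H b\<close> there is room
      for one more mark than \<open>B\<close> has elements; the summand \<open>K\<close> in the
      length meets the threshold of \<open>coincidence\<close>.\<close>
    have "\<forall>k\<in>{..card B}. \<exists>u v. d (H u) (g \<otimes> H v) \<le> 2 * R + 7 * K \<and> \<bar>d (H a) (H u) - real k * S\<bar> \<le> R + 3 * K"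
    proof
      fix k assume "k \<in> {..card B}"
      then have le: "real k * S \<le> real (card B) * S" using S by simp
      have "0 \<le> real (card B) * S" "0 \<le> real k * S" using S by simp_all
      then show "\<exists>u v. d (H u) (g \<otimes> H v) \<le> 2 * R + 7 * K \<and> \<bar>d (H a) (H u) - real k * S\<bar> \<le> R + 3 * K"
        using far S K_nonneg le unfolding a b by (intro coincidence[OF g a b]) linarith+
    qed
    then obtain u v where uv: "\<And>k. k \<le> card B \<Longrightarrow> d (H (u k)) (g \<otimes> H (v k)) \<le> 2 * R + 7 * K"
      and ut: "\<And>k. k \<le> card B \<Longrightarrow> \<bar>d (H a) (H (u k)) - real k * S\<bar> \<le> R + 3 * K"
      unfolding Ball_def atMost_iff by metis
    define \<beta> where "\<beta> k = inv (H (u k)) \<otimes> g \<otimes> H (v k)" for k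
    have \<beta>d: "d \<one> (\<beta> k) = d (H (u k)) (g \<otimes> H (v k))" for k
      using d_inv[of "g \<otimes> H (v k)" \<one> "H (u k)"] g by (simp add: \<beta>_def m_assoc dist_commute)
    have "\<beta> ` {..card B} \<subseteq> B"
      using uv \<beta>d g by (auto simp: B_def) (auto simp: \<beta>_def)
    then have "card (\<beta> ` {..card B}) < card {..card B}"
      using card_mono[OF B, of "\<beta> ` {..card B}"] by simp
    then have "\<not> inj_on \<beta> {..card B}" using pigeonhole by blast
    then obtain k l where kl: "k \<le> card B" "l \<le> card B" "\<beta> k = \<beta> l" "k \<noteq> l"
      by (auto simp: inj_on_def)
    have une: "u k \<noteq> u l"
    proof
      assume "u k = u l"
      then have "\<bar>real k * S - real l * S\<bar> < S" using ut[OF kl(1)] ut[OF kl(2)] by (simp add: S_def)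
      then have "\<bar>real k - real l\<bar> * S < 1 * S" using S by (simp add: left_diff_distrib[symmetric] abs_mult)
      then have "\<bar>real k - real l\<bar> < 1" using S by (simp only: mult_less_cancel_right)
      then show False using kl(4) by linarith
    qed
    \<comment> \<open>The coincidence \<open>\<beta> k = \<beta> l\<close>, solved for
      \<open>g\<close>, is a commensuration relation.\<close>
    have "g \<otimes> H (v k) = H (u k) \<otimes> \<beta> k" using g by (simp add: \<beta>_def m_assoc[symmetric])
    also have "\<dots> = H (u k) \<otimes> (H (- u l) \<otimes> g \<otimes> H (v l))" by (simp add: kl(3)) (simp add: \<beta>_def H_neg)
    also have "\<dots> = H (u k + - u l) \<otimes> g \<otimes> H (v l)" using g by (simp only: H_add) (simp add: m_assoc)
    finally have e: "g \<otimes> H (v k) \<otimes> H (- v l) = H (u k - u l) \<otimes> g \<otimes> (H (v l) \<otimes> H (- v l))"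
      using g by (simp add: m_assoc)
    then have e': "g \<otimes> H (v k - v l) = H (u k - u l) \<otimes> g"
      using g H_add[of "v k" "- v l"] H_add[of "v l" "- v l"] by (simp add: m_assoc)
    have "v k \<noteq> v l"
    proof
      assume "v k = v l"
      then have "\<one> \<otimes> g = H (u k - u l) \<otimes> g" using e' g by simp
      then have "H (u k - u l) = \<one>" using g by (metis right_cancel int_pow_closed h_closed one_closed)
      then show False using h_inf[of "u k - u l"] une by simp
    qed
    then have "g \<in> E" unfolding E_def using g e' une
      by (intro CollectI conjI exI[of _ "v k - v l"] exI[of _ "u k - u l"]) auto
    moreover have "d \<one> (inv (H (u 0)) \<otimes> g \<otimes> H (v 0)) \<le> 2 * R + 7 * K"
      using uv[of 0] \<beta>d[of 0] by (simp add: \<beta>_def)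
    ultimately show "g \<in> E" "(\<exists>u v. d \<one> (inv (H u) \<otimes> g \<otimes> H v) \<le> 2 * R + 7 * K)" by blast+

  qed
qed

text \<open>A relation \<open>g \<otimes> H p = H q \<otimes> g\<close> keeps
  \<open>g \<otimes> H (p * k)\<close> at the fixed distance \<open>d \<one> g\<close> from
  \<open>H (q * k)\<close> for all \<open>k\<close>, so the projection of
  \<open>g\<langle>h\<rangle>\<close> is unbounded.\<close>

lemma E_overlap:
  assumes "g \<in> E"
  obtains i j where "D < d (pr (g \<otimes> H i)) (pr (g \<otimes> H j))"
proof -
  obtain p q where pq: "p \<noteq> 0" "q \<noteq> 0" "g \<otimes> H p = H q \<otimes> g" and g: "g \<in> carrier G"
    using assms by (auto simp: E_def)
  have near: "d (H (q * k)) (pr (g \<otimes> H (p * k))) \<le> 2 * d \<one> g + K" for k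
  proof -
    have e: "g \<otimes> H (p * k) = H (q * k) \<otimes> g" using conj_pow[OF g pq(3)] .
    have "d (H (q * k)) (g \<otimes> H (p * k)) = d \<one> g" using d_right[of "H (q * k)" g] g by (simp add: e)
    then show ?thesis
      using pr_near[of "g \<otimes> H (p * k)" "q * k"] g
        dist_triangle[of "pt (H (q * k))" "pt (pr (g \<otimes> H (p * k)))" "pt (g \<otimes> H (p * k))"]
      by (simp add: dist_commute)
  qed
  obtain n where n: "n > 0" "\<And>m. n \<le> \<bar>m\<bar> \<Longrightarrow> D + 2 * (2 * d \<one> g + K) < d \<one> (H m)"
    using H_far by blast
  have "n \<le> \<bar>q * n\<bar>" using pq(2) n(1) by (simp add: abs_mult)
  then have "D + 2 * (2 * d \<one> g + K) < d (H 0) (H (q * n))" using n(2) by (simp add: d_H)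
  then have "D < d (pr (g \<otimes> H (p * 0))) (pr (g \<otimes> H (p * n)))"
    using near[of 0] near[of n] dist_triangle[of "pt (H 0)" "pt (H (q * n))" "pt (pr (g \<otimes> H (p * 0)))"]
      dist_triangle[of "pt (pr (g \<otimes> H (p * 0)))" "pt (H (q * n))" "pt (pr (g \<otimes> H (p * n)))"]
    by (simp add: dist_commute)
  then show ?thesis by (rule that)
qed

text \<open>Elements of \<open>E\<close> overlap by more than the uniform constant of
  \<open>overlap_in_E\<close>, so each lies in the double coset of an element of one fixed
  ball.\<close>

lemma E_double_coset:
  assumes "g \<in> E" obtains u v where "d \<one> (inv (H u) \<otimes> g \<otimes> H v) \<le> 2 * R + 7 * K"
proof -
  obtain D where D: "\<forall>g i j. g \<in> carrier G \<longrightarrow> D < d (pr (g \<otimes> H i)) (pr (g \<otimes> H j)) \<longrightarrow>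
     g \<in> E \<and> (\<exists>u v. d \<one> (inv (H u) \<otimes> g \<otimes> H v) \<le> 2 * R + 7 * K)"
    using overlap_in_E by blast
  obtain i j where "D < d (pr (g \<otimes> H i)) (pr (g \<otimes> H j))" by (rule E_overlap[OF assms])
  then show ?thesis using D E_carrier[OF assms] that by blast
qed

lemma H_in_E: "H i \<in> E"
proof -
  have "H i \<otimes> H 1 = H 1 \<otimes> H i" by (simp only: H_add[symmetric] add.commute)
  then show ?thesis unfolding E_def by (intro CollectI conjI exI[of _ 1]) auto
qed

text \<open>\<open>E\<close> is covered by finitely many double cosets of
  \<open>\<langle>h\<rangle>\<close>. In each, a relation
  \<open>b \<otimes> H p = H q \<otimes> b\<close> moves multiples of \<open>p\<close> from the
  right to the left, and only the finitely many remainders modulo \<open>p\<close> stay on the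
  right.\<close>

lemma E_finite_index:
  obtains S where "finite S" "S \<subseteq> carrier G" "E \<subseteq> {H i \<otimes> s | i s. s \<in> S}"
proof -
  interpret E: subgroup E G by (rule E_subgroup)
  define B where "B = {g \<in> E. d \<one> g \<le> 2 * R + 7 * K}"
  have B: "finite B" unfolding B_def by (rule finite_subset[OF _ finite_ball]) (use E.subset in auto)
  have "\<forall>b\<in>B. \<exists>p q. p > 0 \<and> b \<otimes> H p = H q \<otimes> b"
  proof
    fix b assume "b \<in> B"
    then obtain p q where pq: "p \<noteq> 0" "b \<otimes> H p = H q \<otimes> b" and bc: "b \<in> carrier G"
      unfolding B_def E_def by blast
    show "\<exists>p q. p > 0 \<and> b \<otimes> H p = H q \<otimes> b"
    proof (cases "p > 0")
      case False
      then show ?thesis using pq conj_pow[OF bc pq(2), of "-1"]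
        by (intro exI[of _ "-p"] exI[of _ "-q"]) auto
    qed (use pq in blast)
  qed
  from bchoice[OF this] obtain p where "\<forall>b\<in>B. \<exists>q. p b > 0 \<and> b \<otimes> H (p b) = H q \<otimes> b" by blast
  from bchoice[OF this] obtain q
    where pq: "\<And>b. b \<in> B \<Longrightarrow> p b > 0" "\<And>b. b \<in> B \<Longrightarrow> b \<otimes> H (p b) = H (q b) \<otimes> b" by blast
  define S where "S = (\<Union>b\<in>B. (\<lambda>r. b \<otimes> H r) ` {0..<p b})"
  show ?thesis
  proof
    show "finite S" using B by (auto simp: S_def)
    show "S \<subseteq> carrier G" by (auto simp: S_def B_def)
    show "E \<subseteq> {H i \<otimes> s | i s. s \<in> S}"
    proof
      fix g assume gE: "g \<in> E"
      obtain u v where uv: "d \<one> (inv (H u) \<otimes> g \<otimes> H v) \<le> 2 * R + 7 * K" by (rule E_double_coset[OF gE])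
      define b where "b = inv (H u) \<otimes> g \<otimes> H v"
      have b: "b \<in> B" using gE uv H_in_E by (simp add: b_def B_def)
      then have bc: "b \<in> carrier G" by (simp add: B_def)
      have g: "g = H u \<otimes> b \<otimes> H (- v)" using gE by (simp add: b_def H_neg m_assoc) (simp add: m_assoc[symmetric])
      define k r where "k = (- v) div p b" and "r = (- v) mod p b"
      have v: "- v = p b * k + r" unfolding k_def r_def by (rule mult_div_mod_eq[symmetric])
      have "g = H u \<otimes> (b \<otimes> H (p b * k)) \<otimes> H r" using bc unfolding g v H_add by (simp add: m_assoc)
      also have "\<dots> = H u \<otimes> (H (q b * k) \<otimes> b) \<otimes> H r" using conj_pow[OF bc pq(2)[OF b]] by simp
      also have "\<dots> = H (u + q b * k) \<otimes> (b \<otimes> H r)" using bc unfolding H_add by (simp add: m_assoc)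
      finally show "g \<in> {H i \<otimes> s | i s. s \<in> S}"
        using b pq(1)[OF b] by (force simp: S_def r_def)
    qed
  qed
qed

lemma elementary_if_finite_index:
  assumes "finite S" "S \<subseteq> carrier G" "carrier G \<subseteq> {H i \<otimes> s | i s. s \<in> S}"
  shows "elementary_group G"
proof -
  have sub: "subgroup (range H) G"
  proof
    show "\<And>x y. \<lbrakk>x \<in> range H; y \<in> range H\<rbrakk> \<Longrightarrow> x \<otimes> y \<in> range H" by (auto simp flip: H_add)
    show "\<one> \<in> range H" by (metis int_pow_0 rangeI)
    show "\<And>x. x \<in> range H \<Longrightarrow> inv x \<in> range H" by (auto simp flip: H_neg)
  qed auto
  interpret Z: group "G\<lparr>carrier := range H\<rparr>" by (rule subgroup_imp_group[OF sub])
  have h: "h \<in> range H" by (rule range_eqI[of _ _ 1]) simp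
  have "cyclic_group (G\<lparr>carrier := range H\<rparr>)"
    unfolding Z.cyclic_group
    by (rule bexI[of _ h]) (use h in \<open>simp_all add: int_pow_consistent[OF sub, symmetric]\<close>)
  moreover have "rcosets (range H) \<subseteq> (\<lambda>s. range H #> s) ` S"
  proof
    fix C assume "C \<in> rcosets (range H)"
    then obtain g where g: "g \<in> carrier G" "C = range H #> g" by (auto simp: RCOSETS_def)
    then obtain i s where s: "g = H i \<otimes> s" "s \<in> S" using assms(3) by blast
    then have "g \<in> range H #> s" by (auto simp: r_coset_def)
    then have "C = range H #> s" using repr_independence[OF _ _ sub, of g s] assms(2) s g by auto
    then show "C \<in> (\<lambda>s. range H #> s) ` S" using s by blast
  qed
  moreover have "infinite (carrier G)"
  proof
    assume "finite (carrier G)"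
    then have "finite (range H)" by (rule finite_subset[rotated]) auto
    then show False using finite_imageD[of H UNIV] H_inj by (auto simp: inj_def)
  qed
  ultimately show ?thesis
    unfolding elementary_group_def using sub assms(1) is_group by (meson finite_imageI finite_subset)
qed

section \<open>Translates of \<open>\<langle>h\<rangle>\<close> by elements outside
  \<open>E\<close>\<close>

lemma overlap_bounded:
  "\<exists>D\<ge>0. \<forall>g i j. g \<in> carrier G - E \<longrightarrow> d (pr (g \<otimes> H i)) (pr (g \<otimes> H j)) \<le> D"
proof -
  obtain D where "D \<ge> 0" and D: "\<forall>g i j. g \<in> carrier G \<longrightarrow> D < d (pr (g \<otimes> H i)) (pr (g \<otimes> H j)) \<longrightarrow>
     g \<in> E \<and> (\<exists>u v. d \<one> (inv (H u) \<otimes> g \<otimes> H v) \<le> 2 * R + 7 * K)"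
    using overlap_in_E by blast
  then show ?thesis by (meson DiffD1 DiffD2 linorder_not_less)
qed

lemma inv_notin_E: "g \<in> carrier G - E \<Longrightarrow> inv g \<in> carrier G - E"
  using subgroup.m_inv_closed[OF E_subgroup, of "inv g"] by auto

text \<open>Behrstock's inequality for the sets \<open>\<langle>h\<rangle>\<close> and \<open>g\<langle>h\<rangle>\<close>.\<close>

lemma step:
  "\<exists>C\<ge>0. \<forall>g\<in>carrier G - E. \<forall>y\<in>carrier G. C < d (pr y) (pr (inv g)) \<longrightarrow> d (pr (g \<otimes> y)) (pr g) \<le> C"
proof -
  obtain D where D0: "D \<ge> 0" and D: "\<And>g i j. g \<in> carrier G - E \<Longrightarrow> d (pr (g \<otimes> H i)) (pr (g \<otimes> H j)) \<le> D"
    using overlap_bounded by blast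
  \<comment> \<open>The contrapositive: \<open>D\<close> bounds the diameter of the projection of
    \<open>g\<langle>h\<rangle>\<close>, and \<open>K\<close> is the threshold of
    contraction.\<close>
  have "d (pr y) (pr (inv g)) \<le> K + D"
    if g: "g \<in> carrier G - E" and y: "y \<in> carrier G" and far: "K + D < d (pr (g \<otimes> y)) (pr g)" for g y
  proof -
    have gc: "g \<in> carrier G" using g by simp
    obtain v :: int where v: "pr y = H v" using pr_pow y by blast
    obtain i :: int where i: "pr (g \<otimes> y) = H i" using pr_pow[of "g \<otimes> y"] gc y by blast
    have "K < d (pr (g \<otimes> y)) (pr (g \<otimes> H v))"
      using far D[OF g, of 0 v] gc dist_triangle[of "pt (pr (g \<otimes> y))" "pt (pr g)" "pt (pr (g \<otimes> H v))"]
      by (simp add: dist_commute)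
    \<comment> \<open>The path from \<open>g \<otimes> y\<close> to the translated projection
      \<open>g \<otimes> H v\<close> must first reach \<open>\<langle>h\<rangle>\<close> at
      \<open>H i\<close> and then travel more than \<open>K\<close> along it.\<close>
    then have "d (g \<otimes> y) (H i) + K \<le> d (g \<otimes> y) (g \<otimes> H v) + K"
      using pr_contract[of "g \<otimes> y" "g \<otimes> H v"] gc y zero_le_dist[of "pt (pr (g \<otimes> H v))" "pt (g \<otimes> H v)"]
      unfolding i by (smt (verit) m_closed int_pow_closed h_closed)
    then have 1: "d y (inv g \<otimes> H i) \<le> d y (H v)"
      using gc y d_inv[of "H i" y g] left_inv[of y "H v" g] by (simp add: dist_commute)
    \<comment> \<open>\<open>inv g \<otimes> H i\<close> is no farther from \<open>y\<close> than
      \<open>pr y\<close>. If its projection were more than \<open>K\<close> away from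
      \<open>pr y\<close>, contraction would make it farther.\<close>
    have "d (pr y) (pr (inv g \<otimes> H i)) \<le> K"
    proof (rule ccontr)
      assume "\<not> d (pr y) (pr (inv g \<otimes> H i)) \<le> K"
      then show False
        using pr_contract[of y "inv g \<otimes> H i"] 1 gc y zero_le_dist[of "pt (pr (inv g \<otimes> H i))" "pt (inv g \<otimes> H i)"]
        unfolding v by (smt (verit) m_closed int_pow_closed h_closed inv_closed)
    qed
    moreover have "d (pr (inv g \<otimes> H i)) (pr (inv g)) \<le> D"
      using D[OF inv_notin_E[OF g], of i 0] gc by simp
    ultimately show ?thesis
      using dist_triangle[of "pt (pr y)" "pt (pr (inv g))" "pt (pr (inv g \<otimes> H i))"] by linarith
  qed
  then show ?thesis using K_nonneg D0 by (intro exI[of _ "K + D"]) force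
qed

text \<open>Infinitely many elements are spread over finitely many cosets of
  \<open>\<langle>h\<rangle>\<close>, so two of them share one.\<close>

lemma infinite_in_E:
  assumes "infinite A" "A \<subseteq> E"
  obtains x y m where "x \<in> A" "y \<in> A" "m \<noteq> 0" "x = H m \<otimes> y"
proof -
  obtain S where S: "finite S" "S \<subseteq> carrier G" "E \<subseteq> {H i \<otimes> s | i s. s \<in> S}" by (rule E_finite_index)
  then have "\<forall>x\<in>A. \<exists>s. s \<in> S \<and> (\<exists>i. x = H i \<otimes> s)" using assms(2) by blast
  from bchoice[OF this] obtain s where s: "\<And>x. x \<in> A \<Longrightarrow> s x \<in> S" "\<And>x. x \<in> A \<Longrightarrow> \<exists>i. x = H i \<otimes> s x"
    by blast
  have "finite (s ` A)" using s(1) by (intro finite_subset[OF _ S(1)]) blast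
  then have "\<not> inj_on s A" using assms(1) finite_imageD by blast
  then obtain x y where xy: "x \<in> A" "y \<in> A" "x \<noteq> y" "s x = s y" by (auto simp: inj_on_def)
  obtain i j where ij: "x = H i \<otimes> s x" "y = H j \<otimes> s x" using s(2) xy by metis
  have sc: "s x \<in> carrier G" using s(1) xy S by blast
  have "H (i - j) \<otimes> y = H (i - j) \<otimes> H j \<otimes> s x" unfolding ij(2)[symmetric] using sc
    by (subst ij(2)) (simp add: m_assoc)
  also have "\<dots> = x" using ij(1) by (simp flip: H_add)
  finally have "x = H (i - j) \<otimes> y" by simp
  moreover have "i - j \<noteq> 0" using ij xy(3) by auto
  ultimately show ?thesis using that xy by blast
qed

section \<open>Consequences of non-elementarity\<close>

lemma nonelementary_not_E:
  assumes "\<not> elementary_group G" shows "\<not> carrier G \<subseteq> E"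
proof
  assume all: "carrier G \<subseteq> E"
  obtain S where "finite S" "S \<subseteq> carrier G" "E \<subseteq> {H i \<otimes> s | i s. s \<in> S}" by (rule E_finite_index)
  then show False using elementary_if_finite_index[of S] all assms by blast
qed

text \<open>If \<Gamma> lies in \<open>E\<close>, then it contains a power \<open>H m\<close> with
  \<open>m \<noteq> 0\<close>, hence all conjugates
  \<open>g \<otimes> H (m * j) \<otimes> inv g\<close>. Two of these differ by a power of
  \<open>h\<close>, which is a commensuration relation for \<open>g\<close>. So every
  \<open>g\<close> lies in \<open>E\<close>, against non-elementarity.\<close>

lemma normal_not_in_E:
  assumes ne: "\<not> elementary_group G" and N: "\<Gamma> \<lhd> G" and inf: "infinite \<Gamma>"
  shows "\<exists>\<gamma>\<in>\<Gamma>. \<gamma> \<notin> E"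
proof (rule ccontr)
  assume "\<not> (\<exists>\<gamma>\<in>\<Gamma>. \<gamma> \<notin> E)"
  then have sub: "\<Gamma> \<subseteq> E" by blast
  interpret N: normal \<Gamma> G by fact
  obtain x y m where xy: "x \<in> \<Gamma>" "y \<in> \<Gamma>" "m \<noteq> 0" "x = H m \<otimes> y"
    by (rule infinite_in_E[OF inf sub])
  then have "H m = x \<otimes> inv y" by (simp add: m_assoc)
  then have Hm: "H m \<in> \<Gamma>" using N.m_closed[OF xy(1) N.m_inv_closed[OF xy(2)]] by simp
  have "g \<in> E" if g: "g \<in> carrier G" for g
  proof -
    define c where "c j = g \<otimes> H (m * j) \<otimes> inv g" for j
    have "c j \<in> \<Gamma>" for j
    proof -
      have "H (m * j) \<in> \<Gamma>"
        using N.subgroup_axioms Hm subgroup_int_pow_closed[of \<Gamma> "H m" j] by (simp add: H_mult_pow)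
      then show ?thesis unfolding c_def using N.inv_op_closed2 g by blast
    qed
    then have cE: "range c \<subseteq> E" using sub by blast
    have "inj c" using xy(3) g by (auto simp: inj_def c_def H_inj)
    then have "infinite (range c)" using finite_image_iff[of c UNIV] by (simp add: infinite_UNIV_int)
    then obtain a b n where ab: "a \<in> range c" "b \<in> range c" "n \<noteq> 0" "a = H n \<otimes> b"
      by (rule infinite_in_E[OF _ cE])
    then obtain j k where jk: "g \<otimes> H (m * j) \<otimes> inv g = H n \<otimes> (g \<otimes> H (m * k) \<otimes> inv g)"
      unfolding c_def by blast
    have "j \<noteq> k"
    proof
      assume "j = k"
      then have "\<one> \<otimes> (g \<otimes> H (m * k) \<otimes> inv g) = H n \<otimes> (g \<otimes> H (m * k) \<otimes> inv g)" using jk g by simp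
      then have "H n = \<one>" using g right_cancel[of "g \<otimes> H (m * k) \<otimes> inv g" \<one> "H n"] by simp
      then show False using h_inf ab by blast
    qed
    have "g \<otimes> H (m * j) = H n \<otimes> g \<otimes> H (m * k)"
      using arg_cong[OF jk, of "\<lambda>x. x \<otimes> g"] g by (simp add: m_assoc)
    then have "g \<otimes> H (m * j) \<otimes> H (- (m * k)) = H n \<otimes> g \<otimes> H (m * k) \<otimes> H (- (m * k))" by simp
    then have "g \<otimes> H (m * j + - (m * k)) = H n \<otimes> g \<otimes> H (m * k + - (m * k))"
      using g unfolding H_add by (simp add: m_assoc)
    then have "g \<otimes> H (m * (j - k)) = H n \<otimes> g" using g by (simp add: right_diff_distrib)
    then show ?thesis unfolding E_def using g \<open>j \<noteq> k\<close> xy(3) ab(3)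
      by (intro CollectI conjI exI[of _ "m * (j - k)"] exI[of _ n]) auto
  qed
  then show False using nonelementary_not_E[OF ne] by blast
qed

text \<open>Otherwise, after taking inverses, each element lies in \<open>E\<close> or in the
  translate of \<open>E\<close> by \<open>inv k\<close> on the right. Both are covered by finitely
  many cosets of \<open>\<langle>h\<rangle>\<close>, so \<open>G\<close> would be elementary. The
  identity, \<open>k\<close> and \<open>l\<close> then lie in three different left cosets of
  \<open>E\<close>.\<close>

lemma three_cosets:
  assumes "\<not> elementary_group G"
  obtains k l where "k \<in> carrier G - E" "l \<in> carrier G - E" "inv k \<otimes> l \<in> carrier G - E"
proof -
  obtain S where S: "finite S" "S \<subseteq> carrier G" "E \<subseteq> {H i \<otimes> s | i s. s \<in> S}" by (rule E_finite_index)
  obtain k where k: "k \<in> carrier G" "k \<notin> E" using nonelementary_not_E[OF assms] by blast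
  have "\<exists>l\<in>carrier G. l \<notin> E \<and> inv k \<otimes> l \<notin> E"
  proof (rule ccontr)
    assume *: "\<not> (\<exists>l\<in>carrier G. l \<notin> E \<and> inv k \<otimes> l \<notin> E)"
    have "carrier G \<subseteq> {H i \<otimes> s | i s. s \<in> S \<union> (\<lambda>s. s \<otimes> inv k) ` S}"
    proof
      fix g assume g: "g \<in> carrier G"
      then consider "inv g \<in> E" | "inv k \<otimes> inv g \<in> E" using * inv_closed by blast
      then show "g \<in> {H i \<otimes> s | i s. s \<in> S \<union> (\<lambda>s. s \<otimes> inv k) ` S}"
      proof cases
        case 1
        then have "g \<in> E" using subgroup.m_inv_closed[OF E_subgroup, of "inv g"] g by simp
        then show ?thesis using S by blast
      next
        case 2
        then have "g \<otimes> k \<in> E"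
          using subgroup.m_inv_closed[OF E_subgroup, of "inv k \<otimes> inv g"] g k by (simp add: inv_mult_group)
        then obtain i s where s: "s \<in> S" "g \<otimes> k = H i \<otimes> s" using S by blast
        have "g = g \<otimes> k \<otimes> inv k" using g k by (simp add: m_assoc)
        also have "\<dots> = H i \<otimes> (s \<otimes> inv k)" using s S k by (auto simp: m_assoc)
        finally show ?thesis using s by blast
      qed
    qed
    then have "elementary_group G"
      by (rule elementary_if_finite_index[rotated 2]) (use S k in auto)
    then show False using assms by blast
  qed
  then show ?thesis using that k by auto
qed

text \<open>Each of \<open>g\<close> and \<open>inv g\<close> projects far from the base on at most
  one of three translates \<open>a\<langle>h\<rangle>\<close>, so some \<open>a\<close> serves both.
  The right factor \<open>a\<close> of the conjugate moves the projection by a bounded amount,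
  because \<open>pr\<close> is coarsely Lipschitz.\<close>

lemma conjugator_selection:
  assumes "\<not> elementary_group G"
  shows "\<exists>Ks D. finite Ks \<and> Ks \<subseteq> carrier G \<and>
    (\<forall>g\<in>carrier G. \<exists>k\<in>Ks. d \<one> (pr (inv k \<otimes> g \<otimes> k)) \<le> D \<and> d \<one> (pr (inv k \<otimes> inv g \<otimes> k)) \<le> D)"
proof -
  obtain k1 k2 where k: "k1 \<in> carrier G - E" "k2 \<in> carrier G - E" "inv k1 \<otimes> k2 \<in> carrier G - E"
    by (rule three_cosets[OF assms])
  define Ks where "Ks = {\<one>, k1, k2}"
  have Ksc: "Ks \<subseteq> carrier G" using k by (simp add: Ks_def)
  have "inv k2 \<otimes> k1 \<in> carrier G - E" using inv_notin_E[OF k(3)] k(1,2) by (simp add: inv_mult_group)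
  then have pair: "inv a \<otimes> b \<in> carrier G - E" if "a \<in> Ks" "b \<in> Ks" "a \<noteq> b" for a b
    using that k inv_notin_E[OF k(1)] inv_notin_E[OF k(2)] by (auto simp: Ks_def)
  have "\<one> \<in> E" using subgroup.one_closed[OF E_subgroup] .
  then have dis: "\<one> \<noteq> k1" "\<one> \<noteq> k2" "k1 \<noteq> k2" using k by auto
  obtain C where C: "\<And>g y. \<lbrakk>g \<in> carrier G - E; y \<in> carrier G; C < d (pr y) (pr (inv g))\<rbrakk> \<Longrightarrow> d (pr (g \<otimes> y)) (pr g) \<le> C"
    using step by blast
  have "finite ((\<lambda>(a, b). d \<one> (pr (inv a \<otimes> b)) + d \<one> a) ` (Ks \<times> Ks))" by (simp add: Ks_def)
  then obtain M where M0: "\<And>x. x \<in> (\<lambda>(a, b). d \<one> (pr (inv a \<otimes> b)) + d \<one> a) ` (Ks \<times> Ks) \<Longrightarrow> x \<le> M"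
    by (meson bdd_above_finite bdd_above.E)
  have M: "d \<one> (pr (inv a \<otimes> b)) \<le> M" "d \<one> a \<le> M" if "a \<in> Ks" "b \<in> Ks" for a b
  proof -
    have "d \<one> (pr (inv a \<otimes> b)) + d \<one> a \<le> M" by (rule M0) (use that in force)
    then show "d \<one> (pr (inv a \<otimes> b)) \<le> M" "d \<one> a \<le> M"
      using zero_le_dist[of "pt \<one>" "pt (pr (inv a \<otimes> b))"] zero_le_dist[of "pt \<one>" "pt a"] by linarith+
  qed
  \<comment> \<open>The projection of \<open>y\<close> to \<open>a\<langle>h\<rangle>\<close> is
    read off from \<open>inv a \<otimes> y\<close>. If it is far out for \<open>b\<close>, then
    \<open>step\<close> for \<open>inv a \<otimes> b\<close> places it near the base for
    \<open>a\<close>.\<close>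
  have one_bad: "d \<one> (pr (inv a \<otimes> y)) \<le> C + M \<or> d \<one> (pr (inv b \<otimes> y)) \<le> C + M"
    if ab: "a \<in> Ks" "b \<in> Ks" "a \<noteq> b" and y: "y \<in> carrier G" for a b y
  proof (rule disjCI)
    assume far: "\<not> d \<one> (pr (inv b \<otimes> y)) \<le> C + M"
    have c: "a \<in> carrier G" "b \<in> carrier G" using ab Ksc by auto
    have i: "inv (inv a \<otimes> b) = inv b \<otimes> a" using c by (simp add: inv_mult_group)
    have e: "inv a \<otimes> b \<otimes> (inv b \<otimes> y) = inv a \<otimes> y" using c y by (metis inv_closed inv_solve_left m_assoc m_closed)
    have "C < d (pr (inv b \<otimes> y)) (pr (inv b \<otimes> a))"
      using far M(1)[of b a] ab dist_triangle[of "pt \<one>" "pt (pr (inv b \<otimes> y))" "pt (pr (inv b \<otimes> a))"]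
      by (simp add: dist_commute)
    then have "d (pr (inv a \<otimes> y)) (pr (inv a \<otimes> b)) \<le> C"
      using C[OF pair[OF ab], of "inv b \<otimes> y"] c y unfolding i e by simp
    then show "d \<one> (pr (inv a \<otimes> y)) \<le> C + M"
      using M(1)[of a b] ab dist_triangle[of "pt \<one>" "pt (pr (inv a \<otimes> y))" "pt (pr (inv a \<otimes> b))"]
      by (simp add: dist_commute)
  qed
  show ?thesis
  proof (intro exI conjI ballI)
    show "finite Ks" by (simp add: Ks_def)
    show "Ks \<subseteq> carrier G" by fact
    fix g assume g: "g \<in> carrier G"
    have mem: "\<one> \<in> Ks" "k1 \<in> Ks" "k2 \<in> Ks" by (auto simp: Ks_def)
    obtain a where a: "a \<in> Ks" "d \<one> (pr (inv a \<otimes> g)) \<le> C + M" "d \<one> (pr (inv a \<otimes> inv g)) \<le> C + M"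
      using one_bad[OF mem(1,2) dis(1) g] one_bad[OF mem(1,3) dis(2) g] one_bad[OF mem(2,3) dis(3) g]
        one_bad[OF mem(1,2) dis(1), of "inv g"] one_bad[OF mem(1,3) dis(2), of "inv g"]
        one_bad[OF mem(2,3) dis(3), of "inv g"] g mem by blast
    have ac: "a \<in> carrier G" using a Ksc by blast
    have mv: "d \<one> (pr (x \<otimes> a)) \<le> C + M + (M + K)" if x: "x \<in> carrier G" "d \<one> (pr x) \<le> C + M" for x
      using pr_lipschitz[of x "x \<otimes> a"] d_right[of x a] M(2)[OF a(1) a(1)] x ac
        dist_triangle[of "pt \<one>" "pt (pr (x \<otimes> a))" "pt (pr x)"] by simp
    show "\<exists>k\<in>Ks. d \<one> (pr (inv k \<otimes> g \<otimes> k)) \<le> C + M + (M + K) \<and> d \<one> (pr (inv k \<otimes> inv g \<otimes> k)) \<le> C + M + (M + K)"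
      using mv[OF _ a(2)] mv[OF _ a(3)] ac g a(1) by blast
  qed
qed

end

section \<open>Free words\<close>

definition (in group) word_prod :: "('c \<Rightarrow> 'a) \<Rightarrow> 'c list \<Rightarrow> 'a" where
  "word_prod u w = foldr (\<lambda>b z. u b \<otimes> z) w \<one>"

lemma (in group) word_prod_simps [simp]:
  "word_prod u [] = \<one>" "word_prod u (b # w) = u b \<otimes> word_prod u w"
  by (simp_all add: word_prod_def)

lemma (in group) word_prod_closed:
  assumes "\<And>b. b \<in> B \<Longrightarrow> u b \<in> carrier G" "set w \<subseteq> B"
  shows "word_prod u w \<in> carrier G"
  using assms(2) by (induction w) (use assms(1) in auto)

text \<open>Recover the first letter, cancel it and induct. With the length fixed, the empty word is
  never compared with a longer one.\<close>

lemma (in group) word_prod_inj: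
  assumes u: "\<And>b. b \<in> B \<Longrightarrow> u b \<in> carrier G"
    and first: "\<And>b b' w w'. \<lbrakk>b \<in> B; b' \<in> B; set w \<subseteq> B; set w' \<subseteq> B;
      u b \<otimes> word_prod u w = u b' \<otimes> word_prod u w'\<rbrakk> \<Longrightarrow> b = b'"
  shows "inj_on (word_prod u) {w. set w \<subseteq> B \<and> length w = k}"
proof (induction k)
  case (Suc k)
  show ?case
  proof (rule inj_onI)
    fix v v' assume "v \<in> {w. set w \<subseteq> B \<and> length w = Suc k}" "v' \<in> {w. set w \<subseteq> B \<and> length w = Suc k}"
      and e: "word_prod u v = word_prod u v'"
    then obtain b w b' w' where v: "v = b # w" "v' = b' # w'" "b \<in> B" "b' \<in> B" "set w \<subseteq> B" "set w' \<subseteq> B"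
      "length w = k" "length w' = k"
      by (auto simp: length_Suc_conv)
    then have "b = b'" using first[of b b' w w'] e by simp
    moreover have "word_prod u w = word_prod u w'"
      using e v word_prod_closed[of B u] u \<open>b = b'\<close> by simp
    ultimately show "v = v'" using Suc.IH v by (auto dest: inj_onD)
  qed
qed (auto intro: inj_onI)

section \<open>A free pair from one element outside \<open>E\<close>\<close>

context contracting_group begin

lemma d_H_neg: "d \<one> (H (- n)) = d \<one> (H n)"
  using d_inv_one[of "H n"] by (simp add: H_neg)

lemma pr_shift_near:
  assumes "g \<in> carrier G" "x \<in> carrier G" "d x (pr g) \<le> c"
  shows "d (H n \<otimes> x) (pr (H n \<otimes> g)) \<le> c + 4 * K"
  using pr_shift[OF assms(1), of n] assms left_inv[of x "pr g" "H n"]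
    dist_triangle[of "pt (H n \<otimes> x)" "pt (pr (H n \<otimes> g))" "pt (H n \<otimes> pr g)"]
  by (simp add: dist_commute)

lemma pr_one_near: "d \<one> (pr \<one>) \<le> K"
  using pr_near[of \<one> 0] by simp

lemma pr_shift_one:
  assumes "g \<in> carrier G" "d \<one> (pr g) \<le> c"
  shows "d (H n) (pr (H n \<otimes> g)) \<le> c + 4 * K"
  using pr_shift_near[of g \<one> c n] assms by simp

text \<open>Two words \<open>h\<^sup>m \<gamma> \<cdots>\<close> with exponents in \<open>{n, 2n}\<close>: the projection to \<open>\<langle>h\<rangle>\<close> recovers
  the first exponent.\<close>

lemma free_pair:
  assumes \<gamma>: "\<gamma> \<in> carrier G - E"
  shows "\<exists>n. n \<noteq> 0 \<and> (\<forall>k. inj_on (word_prod (\<lambda>m. H m \<otimes> \<gamma>)) {w. set w \<subseteq> {n, 2 * n} \<and> length w = k})"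
proof -
  obtain C where C0: "0 \<le> C" and C: "\<And>g y. \<lbrakk>g \<in> carrier G - E; y \<in> carrier G; C < d (pr y) (pr (inv g))\<rbrakk> \<Longrightarrow> d (pr (g \<otimes> y)) (pr g) \<le> C"
    using step by blast
  define c where "c = C + d \<one> (pr \<gamma>)"
  have c0: "0 \<le> c" using C0 by (simp add: c_def)
  \<comment> \<open>Letters must be long enough for two purposes: \<open>step\<close> needs
    \<open>H m\<close> far from \<open>pr (inv \<gamma>)\<close>, and different letters must be told
    apart despite errors of total size \<open>2 * c + 8 * K\<close>.\<close>
  obtain n where n: "n > 0" "\<And>m. n \<le> \<bar>m\<bar> \<Longrightarrow> C + 2 * c + 8 * K + d \<one> (pr (inv \<gamma>)) < d \<one> (H m)"
    using H_far by blast
  let ?B = "{n, 2 * n}" and ?u = "\<lambda>m. H m \<otimes> \<gamma>"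
  have \<gamma>c: "\<gamma> \<in> carrier G" using \<gamma> by simp
  have cl: "word_prod ?u w \<in> carrier G" if "set w \<subseteq> ?B" for w
    by (rule word_prod_closed[OF _ that]) (use \<gamma>c in simp)
  have near: "d (H m) (pr (H m \<otimes> (\<gamma> \<otimes> z))) \<le> c + 4 * K"
    if "z \<in> carrier G" "d \<one> (pr (\<gamma> \<otimes> z)) \<le> c" for m z
    using pr_shift_one[of "\<gamma> \<otimes> z" c m] that \<gamma>c by simp
  have tail: "d \<one> (pr (\<gamma> \<otimes> word_prod ?u w)) \<le> c" if "set w \<subseteq> ?B" for w
    using that
  proof (induction w)
    case Nil
    then show ?case using \<gamma>c C0 by (simp add: c_def)
  next
    case (Cons m w)
    let ?z = "word_prod ?u w"
    have z: "?z \<in> carrier G" using cl Cons.prems by simp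
    have m: "n \<le> \<bar>m\<bar>" using Cons.prems n(1) by auto
    have e: "word_prod ?u (m # w) = H m \<otimes> (\<gamma> \<otimes> ?z)" using z \<gamma>c by (simp add: m_assoc)
    \<comment> \<open>The word projects near \<open>H m\<close>, far from
      \<open>pr (inv \<gamma>)\<close>; \<open>step\<close> then says that multiplication by
      \<open>\<gamma>\<close> brings the projection back near \<open>pr \<gamma>\<close>.\<close>
    have "C < d (pr (H m \<otimes> (\<gamma> \<otimes> ?z))) (pr (inv \<gamma>))"
      using near[OF z, of m] Cons n(2)[OF m] c0 K_nonneg
        dist_triangle[of "pt \<one>" "pt (H m)" "pt (pr (inv \<gamma>))"]
        dist_triangle[of "pt (pr (inv \<gamma>))" "pt (H m)" "pt (pr (H m \<otimes> (\<gamma> \<otimes> ?z)))"]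
      by (simp add: dist_commute)
    then have "d (pr (\<gamma> \<otimes> word_prod ?u (m # w))) (pr \<gamma>) \<le> C"
      using C[OF \<gamma>, of "word_prod ?u (m # w)"] z \<gamma>c unfolding e by simp
    then show ?case
      using dist_triangle[of "pt \<one>" "pt (pr (\<gamma> \<otimes> word_prod ?u (m # w)))" "pt (pr \<gamma>)"]
      by (simp add: c_def dist_commute)
  qed
  have "inj_on (word_prod ?u) {w. set w \<subseteq> ?B \<and> length w = k}" for k
  proof (rule word_prod_inj)
    fix b b' w w' assume b: "b \<in> ?B" "b' \<in> ?B" and w: "set w \<subseteq> ?B" "set w' \<subseteq> ?B"
      and e: "?u b \<otimes> word_prod ?u w = ?u b' \<otimes> word_prod ?u w'"
    show "b = b'"
    proof (rule ccontr)
      assume "b \<noteq> b'"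
      \<comment> \<open>The exponents \<open>n\<close> and \<open>2 * n\<close> differ by
        \<open>n\<close>, so one projection cannot be near both powers.\<close>
      then have "n \<le> \<bar>b' - b\<bar>" using b n(1) by auto
      moreover have "H b \<otimes> (\<gamma> \<otimes> word_prod ?u w) = H b' \<otimes> (\<gamma> \<otimes> word_prod ?u w')"
        using e cl w \<gamma>c by (simp add: m_assoc)
      moreover have "2 * c + 8 * K < d \<one> (H (b' - b))" if "n \<le> \<bar>b' - b\<bar>"
        using n(2)[OF that] C0 zero_le_dist[of "pt \<one>" "pt (pr (inv \<gamma>))"] by linarith
      ultimately show False
        using near[OF cl[OF w(1)] tail[OF w(1)], of b] near[OF cl[OF w(2)] tail[OF w(2)], of b']
          d_H[of b b']
          dist_triangle[of "pt (H b)" "pt (H b')" "pt (pr (H b \<otimes> (\<gamma> \<otimes> word_prod ?u w)))"]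
        by (simp add: dist_commute)
    qed
  qed (use \<gamma>c in simp)
  then show ?thesis using n(1) by (intro exI[of _ n]) auto
qed

end

text \<open>The element \<open>f = h\<^sup>n \<gamma> h\<^sup>-\<^sup>n\<close> lies in every normal subgroup containing \<open>\<gamma>\<close>, and its
  path runs along the two contracting sets \<open>\<langle>h\<rangle>\<close> and \<open>h\<^sup>n \<gamma> \<langle>h\<rangle>\<close>.\<close>

locale barrier = contracting_group +
  fixes \<gamma> :: 'a and n :: int and C D A :: real
  assumes C_nonneg: "0 \<le> C" and D_nonneg: "0 \<le> D" and A_nonneg: "0 \<le> A"
    and C: "\<And>g y. \<lbrakk>g \<in> carrier G - E; y \<in> carrier G; C < d (pr y) (pr (inv g))\<rbrakk> \<Longrightarrow> d (pr (g \<otimes> y)) (pr g) \<le> C"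
    and \<gamma>_notin_E: "\<gamma> \<in> carrier G - E"
    and n_large: "100 * (C + D + K + d \<one> (pr \<gamma>) + d \<one> (pr (inv \<gamma>))) + A < d \<one> (H n)"
begin

definition f where "f = H n \<otimes> \<gamma> \<otimes> H (- n)"

text \<open>One common bound for all errors. Here \<open>D\<close> is meant to bound the projections
  of a letter and of its inverse, and \<open>A\<close> the failure of a letter to be shortest in its
  coset; \<open>n_large\<close> makes \<open>H n\<close> longer than
  \<open>100 * Q + A\<close>.\<close>

definition Q where "Q = C + D + K + d \<one> (pr \<gamma>) + d \<one> (pr (inv \<gamma>))"

section \<open>Projections of words containing \<open>f\<close>\<close>

lemma \<gamma>_closed [simp]: "\<gamma> \<in> carrier G"
  using \<gamma>_notin_E by simp

lemma f_closed [simp]: "f \<in> carrier G"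
  by (simp add: f_def)

lemma Q_bounds: "C \<le> Q" "D \<le> Q" "K \<le> Q" "d \<one> (pr \<gamma>) \<le> Q" "d \<one> (pr (inv \<gamma>)) \<le> Q" "0 \<le> Q"
  "C + d \<one> (pr \<gamma>) \<le> Q" "C + d \<one> (pr (inv \<gamma>)) \<le> Q" "C + D \<le> Q"
  "100 * Q + A < d \<one> (H n)" "100 * Q + A < d \<one> (H (- n))"
  using C_nonneg D_nonneg K_nonneg n_large zero_le_dist[of "pt \<one>" "pt (pr \<gamma>)"]
    zero_le_dist[of "pt \<one>" "pt (pr (inv \<gamma>))"]
  unfolding Q_def d_H_neg by linarith+

text \<open>\<open>step\<close> when the projection of \<open>y\<close> is known only through a
  nearby point \<open>x\<close> that is far from the identity.\<close>

lemma step_one: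
  assumes "g \<in> carrier G - E" "y \<in> carrier G" "d x (pr y) \<le> 50 * Q" "d \<one> (pr (inv g)) \<le> Q" "100 * Q < d \<one> x"
  shows "d (pr g) (pr (g \<otimes> y)) \<le> C"
proof -
  have "C < d (pr y) (pr (inv g))"
    using assms(3-) Q_bounds(1,6) dist_triangle[of "pt \<one>" "pt x" "pt (pr (inv g))"]
      dist_triangle[of "pt (pr (inv g))" "pt x" "pt (pr y)"] by (simp add: dist_commute)
  then show ?thesis using C[OF assms(1,2)] by (simp add: dist_commute)
qed

lemma after_\<gamma>:
  assumes "z \<in> carrier G" "d \<one> (pr z) \<le> Q"
  shows "d \<one> (pr (\<gamma> \<otimes> (H (- n) \<otimes> z))) \<le> Q"
proof -
  have "d (H (- n)) (pr (H (- n) \<otimes> z)) \<le> Q + 4 * K" using pr_shift_one[of z Q "-n"] assms by simp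
  then have "d (pr \<gamma>) (pr (\<gamma> \<otimes> (H (- n) \<otimes> z))) \<le> C"
    using Q_bounds A_nonneg assms(1) by (intro step_one[OF \<gamma>_notin_E, of _ "H (- n)"]) auto
  then show ?thesis
    using Q_bounds(7) dist_triangle[of "pt \<one>" "pt (pr (\<gamma> \<otimes> (H (- n) \<otimes> z)))" "pt (pr \<gamma>)"]
    by (simp add: dist_commute)
qed

lemma f_eq: "z \<in> carrier G \<Longrightarrow> f \<otimes> z = H n \<otimes> (\<gamma> \<otimes> (H (- n) \<otimes> z))"
  by (simp add: f_def m_assoc)

lemma pr_f:
  assumes "z \<in> carrier G" "d \<one> (pr z) \<le> Q"
  shows "d (H n) (pr (f \<otimes> z)) \<le> 5 * Q"
  using pr_shift_one[of "\<gamma> \<otimes> (H (- n) \<otimes> z)" Q n] after_\<gamma>[OF assms] Q_bounds(3) assms(1)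
  by (simp add: f_eq)

text \<open>The induction step for words: putting \<open>b \<otimes> f\<close> in front reproduces
  the same bound \<open>Q\<close>. After \<open>f\<close> the projection is near \<open>H n\<close>,
  and from there \<open>b\<close> brings it back near \<open>pr b\<close>.\<close>

lemma pr_word:
  assumes "z \<in> carrier G" "d \<one> (pr z) \<le> Q" "b \<in> carrier G - E" "d \<one> (pr b) \<le> D" "d \<one> (pr (inv b)) \<le> D"
  shows "d \<one> (pr (b \<otimes> (f \<otimes> z))) \<le> Q"
proof -
  have "d (pr b) (pr (b \<otimes> (f \<otimes> z))) \<le> C"
    using pr_f[OF assms(1,2)] Q_bounds A_nonneg assms by (intro step_one[of b _ "H n"]) auto
  then show ?thesis
    using Q_bounds(9) assms(4) dist_triangle[of "pt \<one>" "pt (pr (b \<otimes> (f \<otimes> z)))" "pt (pr b)"]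
    by (simp add: dist_commute)
qed

text \<open>The same argument read backwards: the projection of the identity to the second
  contracting set of the path is near \<open>b \<otimes> H n \<otimes> \<gamma>\<close>.\<close>

lemma before_\<gamma>:
  assumes "b \<in> carrier G" "d \<one> (pr (inv b)) \<le> D"
  shows "d \<one> (pr (inv (b \<otimes> H n \<otimes> \<gamma>))) \<le> Q"
proof -
  have e: "inv (b \<otimes> H n \<otimes> \<gamma>) = inv \<gamma> \<otimes> (H (- n) \<otimes> inv b)"
    using assms(1) by (simp add: inv_mult_group H_neg)
  have "d (H (- n)) (pr (H (- n) \<otimes> inv b)) \<le> D + 4 * K" using pr_shift_one[of "inv b" D "-n"] assms by simp
  then have "d (pr (inv \<gamma>)) (pr (inv \<gamma> \<otimes> (H (- n) \<otimes> inv b))) \<le> C"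
    using Q_bounds A_nonneg assms(1) inv_notin_E[OF \<gamma>_notin_E]
    by (intro step_one[of "inv \<gamma>" _ "H (- n)"]) auto
  then show ?thesis
    using Q_bounds(8) dist_triangle[of "pt \<one>" "pt (pr (inv (b \<otimes> H n \<otimes> \<gamma>)))" "pt (pr (inv \<gamma>))"]
    by (simp add: e dist_commute)
qed

text \<open>Shortest paths from the identity to the common value \<open>y\<close> pass near
  \<open>b'\<close>. Compare the projections of \<open>b'\<close> and \<open>y\<close> to the second
  contracting set on the path of \<open>b \<otimes> f\<close>. If they differ, the path from
  \<open>b'\<close> to \<open>y\<close> still passes near \<open>b \<otimes> f\<close>, and
  \<open>d \<one> b \<le> d \<one> b'\<close> forces \<open>b'\<close> to be near \<open>b\<close>.
  If not, \<open>b'\<close> lies beyond that set and could be shortened by cutting out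
  \<open>f\<close>.\<close>

lemma first_letter_close:
  assumes z: "z1 \<in> carrier G" "d \<one> (pr z1) \<le> Q" "z2 \<in> carrier G" "d \<one> (pr z2) \<le> Q"
    and b: "b \<in> carrier G" "d \<one> (pr (inv b)) \<le> D"
    and b': "b' \<in> carrier G" "d \<one> (pr (inv b')) \<le> D"
    and eq: "b \<otimes> (f \<otimes> z1) = b' \<otimes> (f \<otimes> z2)"
    and le: "d \<one> b \<le> d \<one> b'"
    and minimal: "d \<one> b' \<le> d \<one> (b \<otimes> inv f \<otimes> inv b \<otimes> b') + A"
  shows "d b b' \<le> 2 * d \<one> f + 50 * Q"
proof -
  \<comment> \<open>The second contracting set is \<open>v\<langle>h\<rangle>\<close>, entered near
    \<open>v\<close> and left near \<open>v \<otimes> H (- n) = b \<otimes> f\<close>.\<close>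
  define v where "v = b \<otimes> H n \<otimes> \<gamma>"
  define y where "y = b \<otimes> (f \<otimes> z1)"
  have c: "v \<in> carrier G" "y \<in> carrier G" using b z by (simp_all add: v_def y_def)
  have vH: "v \<otimes> H (- n) = b \<otimes> f" using b by (simp add: v_def f_def m_assoc)
  have "inv v \<otimes> y = H (- n) \<otimes> z1"
  proof -
    have "y = v \<otimes> H (- n) \<otimes> z1" using b z by (simp add: vH y_def m_assoc)
    then show ?thesis using c z by (simp add: m_assoc) (simp add: m_assoc[symmetric])
  qed
  then have prz: "d (H (- n)) (pr (inv v \<otimes> y)) \<le> 5 * Q"
    using pr_shift_one[of z1 Q "-n"] z Q_bounds(3) by simp
  have prv: "d \<one> (pr (inv v)) \<le> Q" using before_\<gamma>[OF b] by (simp add: v_def)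
  have iy: "inv b' \<otimes> y = f \<otimes> z2" using b' z unfolding y_def eq by (simp add: m_assoc[symmetric])
  have n: "100 * Q + A < d \<one> (H n)" "100 * Q + A < d \<one> (H (- n))" using Q_bounds by auto
  have Q: "0 \<le> Q" "D \<le> Q" "K \<le> Q" using Q_bounds by auto
  have through_b': "d \<one> b' + d b' y \<le> d \<one> y + 20 * Q"
  proof -
    have pf: "d (pr (inv b' \<otimes> y)) (H n) \<le> 5 * Q" using pr_f[OF z(3,4)] by (simp add: iy dist_commute)
    have "K < d (pr (inv b')) (pr (inv b' \<otimes> y))"
      using b'(2) pf n Q A_nonneg dist_triangle[of "pt \<one>" "pt (H n)" "pt (pr (inv b'))"]
        dist_triangle[of "pt (pr (inv b'))" "pt (H n)" "pt (pr (inv b' \<otimes> y))"] by linarith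
    then have "d (inv b') \<one> + d \<one> (H n) + d (H n) (inv b' \<otimes> y) \<le> d (inv b') (inv b' \<otimes> y) + K + 2 * D + 2 * (5 * Q)"
      using b' c pf by (intro pass) (simp_all add: dist_commute)
    moreover have "d (inv b') (inv b' \<otimes> y) = d \<one> y" using left_inv[of \<one> y "inv b'"] b' c by simp
    moreover have "d \<one> (inv b' \<otimes> y) = d b' y" using d_inv[of y \<one> b'] b' c by (simp add: dist_commute)
    moreover have "d (inv b') \<one> = d \<one> b'" using d_inv_one[of b'] b' by (simp add: dist_commute)
    ultimately show ?thesis
      using Q dist_triangle[of "pt \<one>" "pt (inv b' \<otimes> y)" "pt (H n)"] by linarith
  qed
  show ?thesis
  proof (cases "K < d (pr (inv v \<otimes> b')) (pr (inv v \<otimes> y))")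
    case True
    have "d (inv v \<otimes> b') (pr (inv v \<otimes> b')) + d (pr (inv v \<otimes> b')) (H (- n)) + d (H (- n)) (inv v \<otimes> y)
        \<le> d (inv v \<otimes> b') (inv v \<otimes> y) + K + 2 * 0 + 2 * (5 * Q)"
      using True prz b' c by (intro pass) (simp_all add: dist_commute)
    then have "d (inv v \<otimes> b') (H (- n)) + d (H (- n)) (inv v \<otimes> y) \<le> d (inv v \<otimes> b') (inv v \<otimes> y) + 11 * Q"
      using Q dist_triangle[of "pt (inv v \<otimes> b')" "pt (H (- n))" "pt (pr (inv v \<otimes> b'))"] by linarith
    then have 1: "d b' (b \<otimes> f) + d (b \<otimes> f) y \<le> d b' y + 11 * Q"
      using c b' d_inv[of b' "H (- n)" v] d_inv[of y "H (- n)" v] left_inv[of b' y "inv v"]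
      by (simp add: vH dist_commute)
    have bf: "d b (b \<otimes> f) = d \<one> f" using d_right[of b f] b by simp
    show ?thesis
      using 1 through_b' le bf Q dist_triangle[of "pt \<one>" "pt y" "pt b"] dist_triangle[of "pt b" "pt y" "pt (b \<otimes> f)"]
        dist_triangle[of "pt b" "pt b'" "pt (b \<otimes> f)"] dist_commute[of "pt b'" "pt (b \<otimes> f)"] by linarith
  next
    case False
    have near: "d (pr (inv v \<otimes> b')) (H (- n)) \<le> 6 * Q"
      using False prz Q dist_triangle[of "pt (pr (inv v \<otimes> b'))" "pt (H (- n))" "pt (pr (inv v \<otimes> y))"]
      by (simp add: dist_commute)
    have "K < d (pr (inv v)) (pr (inv v \<otimes> b'))"
      using prv near n Q A_nonneg dist_triangle[of "pt \<one>" "pt (H (- n))" "pt (pr (inv v))"]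
        dist_triangle[of "pt (pr (inv v))" "pt (H (- n))" "pt (pr (inv v \<otimes> b'))"] by linarith
    then have "d (inv v) \<one> + d \<one> (H (- n)) + d (H (- n)) (inv v \<otimes> b') \<le> d (inv v) (inv v \<otimes> b') + K + 2 * Q + 2 * (6 * Q)"
      using b' c near prv by (intro pass) (simp_all add: dist_commute)
    then have 1: "d \<one> v + d \<one> (H (- n)) + d (b \<otimes> f) b' \<le> d \<one> b' + 15 * Q"
      using c b' d_inv_one[of v] d_inv[of b' "H (- n)" v] left_inv[of \<one> b' "inv v"] Q
      by (simp add: vH dist_commute)
    have pg: "d (pr (H n \<otimes> \<gamma>)) (H n) \<le> 5 * Q"
      using pr_shift_one[of \<gamma> Q n] Q_bounds by (simp add: dist_commute)
    have "K < d (pr (inv b)) (pr (H n \<otimes> \<gamma>))"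
      using b(2) pg n Q A_nonneg dist_triangle[of "pt \<one>" "pt (H n)" "pt (pr (inv b))"]
        dist_triangle[of "pt (pr (inv b))" "pt (H n)" "pt (pr (H n \<otimes> \<gamma>))"] by linarith
    then have "d (inv b) \<one> + d \<one> (H n) + d (H n) (H n \<otimes> \<gamma>) \<le> d (inv b) (H n \<otimes> \<gamma>) + K + 2 * D + 2 * (5 * Q)"
      using b pg by (intro pass) (simp_all add: dist_commute)
    moreover have "d (inv b) (H n \<otimes> \<gamma>) = d \<one> v"
      using d_inv[of \<one> "H n \<otimes> \<gamma>" b] b by (simp add: v_def m_assoc)
    moreover have "d (inv b) \<one> = d \<one> b" using d_inv_one[of b] b by (simp add: dist_commute)
    ultimately have 2: "d \<one> b \<le> d \<one> v + 13 * Q"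
      using Q zero_le_dist[of "pt \<one>" "pt (H n)"] zero_le_dist[of "pt (H n)" "pt (H n \<otimes> \<gamma>)"] by linarith
    \<comment> \<open>Multiplication by \<open>?x\<close> moves \<open>b \<otimes> f\<close> to
      \<open>b\<close> and so skips the stretch along \<open>v\<langle>h\<rangle>\<close>, which is
      longer than \<open>A\<close> and all errors together. This contradicts
      \<open>minimal\<close>.\<close>
    let ?x = "b \<otimes> inv f \<otimes> inv b"
    have "inv b \<otimes> (b \<otimes> f) = f" using b by (simp add: m_assoc[symmetric])
    then have "?x \<otimes> (b \<otimes> f) = b" using b by (simp add: m_assoc)
    then have "d b (?x \<otimes> b') = d (b \<otimes> f) b'" using left_inv[of "b \<otimes> f" b' ?x] b b' by simp
    then have "d \<one> b' \<le> d \<one> b + d (b \<otimes> f) b' + A"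
      using minimal dist_triangle[of "pt \<one>" "pt (?x \<otimes> b')" "pt b"] by linarith
    then show ?thesis using 1 2 n Q by linarith
  qed
qed

text \<open>\<open>first_letter_close\<close> is applied with the shorter of the two first letters
  as \<open>b\<close>. Its competitor for minimality stays in the coset because \<open>f\<close>, a
  conjugate of \<open>\<gamma>\<close>, lies in \<Gamma>.\<close>

lemma words_free:
  assumes B: "B \<subseteq> carrier G - E" "\<And>b. b \<in> B \<Longrightarrow> d \<one> (pr b) \<le> D" "\<And>b. b \<in> B \<Longrightarrow> d \<one> (pr (inv b)) \<le> D"
    and N: "\<Gamma> \<lhd> G" "\<gamma> \<in> \<Gamma>"
    and minimal: "\<And>b x. \<lbrakk>b \<in> B; x \<in> \<Gamma>\<rbrakk> \<Longrightarrow> d \<one> b \<le> d \<one> (x \<otimes> b) + A"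
    and separated: "\<And>b b'. \<lbrakk>b \<in> B; b' \<in> B; d b b' \<le> 2 * d \<one> f + 50 * Q\<rbrakk> \<Longrightarrow> b = b'"
  shows "inj_on (word_prod (\<lambda>b. b \<otimes> f)) {w. set w \<subseteq> B \<and> length w = k}"
proof (rule word_prod_inj)
  interpret N: normal \<Gamma> G by fact
  have f\<Gamma>: "f \<in> \<Gamma>" using N.inv_op_closed2[of "H n" \<gamma>] N(2) by (simp add: f_def H_neg)
  show cl: "b \<otimes> f \<in> carrier G" if "b \<in> B" for b using that B by auto
  have tail: "word_prod (\<lambda>b. b \<otimes> f) w \<in> carrier G \<and> d \<one> (pr (word_prod (\<lambda>b. b \<otimes> f) w)) \<le> Q"
    if "set w \<subseteq> B" for w using that
  proof (induction w)
    case Nil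
    then show ?case using pr_one_near Q_bounds(3) by simp
  next
    case (Cons b w)
    then have "b \<in> B" and IH: "word_prod (\<lambda>b. b \<otimes> f) w \<in> carrier G" "d \<one> (pr (word_prod (\<lambda>b. b \<otimes> f) w)) \<le> Q" by auto
    moreover have "b \<in> carrier G - E" using B(1) \<open>b \<in> B\<close> by blast
    ultimately show ?case using pr_word[OF IH, of b] B by (simp add: m_assoc)
  qed
  fix b b' w w' assume b: "b \<in> B" "b' \<in> B" and w: "set w \<subseteq> B" "set w' \<subseteq> B"
    and e: "b \<otimes> f \<otimes> word_prod (\<lambda>b. b \<otimes> f) w = b' \<otimes> f \<otimes> word_prod (\<lambda>b. b \<otimes> f) w'"
  have bc: "b \<in> carrier G" "b' \<in> carrier G" using b B by auto
  have e': "b \<otimes> (f \<otimes> word_prod (\<lambda>b. b \<otimes> f) w) = b' \<otimes> (f \<otimes> word_prod (\<lambda>b. b \<otimes> f) w')"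
    using e bc tail[OF w(1)] tail[OF w(2)] by (simp add: m_assoc)
  have conj: "a \<otimes> inv f \<otimes> inv a \<in> \<Gamma>" if "a \<in> carrier G" for a
    using N.inv_op_closed2[OF that N.m_inv_closed[OF f\<Gamma>]] .
  show "b = b'"
  proof (cases "d \<one> b \<le> d \<one> b'")
    case True
    have "d b b' \<le> 2 * d \<one> f + 50 * Q"
      using tail[OF w(1)] tail[OF w(2)] bc B(3) b e' True minimal[OF b(2) conj[OF bc(1)]]
      by (intro first_letter_close[of "word_prod (\<lambda>b. b \<otimes> f) w" "word_prod (\<lambda>b. b \<otimes> f) w'"]) auto
    then show ?thesis using separated b by blast
  next
    case False
    have "d b' b \<le> 2 * d \<one> f + 50 * Q"
      using tail[OF w(1)] tail[OF w(2)] bc B(3) b e' False minimal[OF b(1) conj[OF bc(2)]]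
      by (intro first_letter_close[of "word_prod (\<lambda>b. b \<otimes> f) w'" "word_prod (\<lambda>b. b \<otimes> f) w"]) auto
    then show ?thesis using separated b by blast
  qed
qed

end

section \<open>Counting\<close>

lemma limsup_ln_le:
  fixes x :: "nat \<Rightarrow> nat"
  assumes "0 \<le> s" "\<And>n. real (x n) \<le> c * exp (s * real n)"
  shows "limsup (\<lambda>n. ereal (ln (real (x n)) / real n)) \<le> ereal s"
proof -
  \<comment> \<open>With \<open>1 \<le> c'\<close> the bound also holds where
    \<open>x n = 0\<close>, since \<open>ln 0 = 0\<close>.\<close>
  define c' where "c' = max c 1"
  have "eventually (\<lambda>n. ereal (ln (real (x n)) / real n) \<le> ereal (ln c' / real n + s)) sequentially"
  proof (intro eventually_sequentiallyI[of 1])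
    fix n :: nat assume n: "1 \<le> n"
    have "ln (real (x n)) \<le> ln c' + s * real n"
    proof (cases "x n = 0")
      case True
      then show ?thesis using assms(1) by (simp add: c'_def)
    next
      case False
      have "real (x n) \<le> c' * exp (s * real n)"
        using assms(2)[of n] by (rule order_trans) (simp add: c'_def)
      then have "ln (real (x n)) \<le> ln (c' * exp (s * real n))" using False by (subst ln_le_cancel_iff) (auto simp: c'_def)
      moreover have "0 < c'" by (simp add: c'_def)
      ultimately show ?thesis by (simp add: ln_mult)
    qed
    then show "ereal (ln (real (x n)) / real n) \<le> ereal (ln c' / real n + s)"
      using n by (simp add: field_simps)
  qed
  then have "limsup (\<lambda>n. ereal (ln (real (x n)) / real n)) \<le> limsup (\<lambda>n. ereal (ln c' / real n + s))"
    by (rule Limsup_mono)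
  also have "(\<lambda>n. ln c' / real n + s) \<longlonglongrightarrow> 0 + s"
    by (intro tendsto_intros lim_const_over_n)
  then have "limsup (\<lambda>n. ereal (ln c' / real n + s)) = ereal s"
    by (intro lim_imp_Limsup) auto
  finally show ?thesis .
qed

lemma limsup_ln_ge:
  fixes x :: "nat \<Rightarrow> nat"
  assumes "0 \<le> s" "\<And>c. \<exists>n. c * exp (s * real n) < real (x n)"
  shows "ereal s \<le> limsup (\<lambda>n. ereal (ln (real (x n)) / real n))"
proof (rule ccontr)
  assume "\<not> ?thesis"
  then have "eventually (\<lambda>n. ereal (ln (real (x n)) / real n) < ereal s) sequentially"
    by (intro Limsup_lessD) auto
  then obtain m where m: "\<And>n. m \<le> n \<Longrightarrow> ln (real (x n)) / real n < s"
    by (auto simp: eventually_sequentially)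
  \<comment> \<open>This constant exceeds every \<open>x n\<close> with \<open>n \<le> m\<close>, so
    the \<open>n\<close> obtained for it lies beyond \<open>m\<close>.\<close>
  define c where "c = 1 + (\<Sum>n\<le>m. real (x n))"
  have c1: "1 \<le> c" by (simp add: c_def sum_nonneg)
  obtain n where n: "c * exp (s * real n) < real (x n)" using assms(2) by blast
  have e1: "1 \<le> exp (s * real n)" using assms(1) by simp
  show False
  proof (cases "n \<le> m")
    case True
    then have "real (x n) \<le> c" unfolding c_def using member_le_sum[of n "{..m}" "\<lambda>n. real (x n)"] by simp
    also have "c * 1 \<le> c * exp (s * real n)" using e1 c1 by (intro mult_left_mono) auto
    finally show False using n by simp
  next
    case False
    have "exp (s * real n) \<le> c * exp (s * real n)" using c1 by simp
    then have less: "exp (s * real n) < real (x n)" using n by linarith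
    then have "s * real n < ln (real (x n))" by (metis exp_gt_zero ln_exp ln_less_cancel_iff order_less_trans)
    then show False using m[of n] False by (simp add: field_simps)
  qed
qed

text \<open>Fekete's lemma for \<open>ln (C a\<^sub>n)\<close>.\<close>

lemma submultiplicative_rate:
  fixes a :: "nat \<Rightarrow> real"
  assumes a1: "\<And>n. 1 \<le> a n" and C1: "1 \<le> C" and sub: "\<And>n m. a (n + m) \<le> C * a n * a m"
  obtains \<sigma> where "0 \<le> \<sigma>" "\<And>n. exp (\<sigma> * real n) \<le> C * a n"
    "\<And>s. \<sigma> < s \<Longrightarrow> \<exists>c. \<forall>n. a n \<le> c * exp (s * real n)"
proof -
  define u where "u n = ln (C * a n)" for n
  have Ca: "1 \<le> C * a n" for n using mult_mono[of 1 C 1 "a n"] a1[of n] C1 by simp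
  have expu: "exp (u n) = C * a n" for n using Ca[of n] by (simp add: u_def)
  have u0: "0 \<le> u n" for n using Ca by (simp add: u_def)
  have usub: "u (n + m) \<le> u n + u m" for n m
  proof -
    have "C * a (n + m) \<le> (C * a n) * (C * a m)"
      using mult_left_mono[OF sub[of n m], of C] C1 by (simp add: mult_ac)
    then have "exp (u (n + m)) \<le> exp (u n + u m)" by (simp add: expu exp_add)
    then show ?thesis by simp
  qed
  have umul: "u (q * m + r) \<le> real q * u m + u r" for q m r
  proof (induction q)
    case (Suc q)
    then show ?case using usub[of m "q * m + r"] by (simp add: algebra_simps)
  qed simp
  \<comment> \<open>As an infimum, \<sigma> gives the lower bound at every single \<open>n\<close>
    and not only in the limit.\<close>
  define \<sigma> where "\<sigma> = (INF n\<in>{1..}. u n / real n)"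
  have bdd: "bdd_below ((\<lambda>n. u n / real n) ` {1..})" using u0 by (intro bdd_belowI[of _ 0]) auto
  show ?thesis
  proof
    show "0 \<le> \<sigma>" unfolding \<sigma>_def by (intro cINF_greatest) (use u0 in auto)
    show "exp (\<sigma> * real n) \<le> C * a n" for n
    proof (cases "n = 0")
      case False
      then have "\<sigma> \<le> u n / real n" unfolding \<sigma>_def using bdd by (intro cINF_lower) auto
      then have "exp (\<sigma> * real n) \<le> exp (u n)" using False by (simp add: field_simps)
      then show ?thesis by (simp add: expu)
    qed (use Ca in simp)
    fix s assume "\<sigma> < s"
    then obtain m where m: "1 \<le> m" "u m / real m < s"
      unfolding \<sigma>_def using cINF_less_iff[OF _ bdd] by auto
    have s0: "0 < s" using m(2) u0[of m] by (meson divide_nonneg_nonneg of_nat_0_le_iff order_le_less_trans)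
    \<comment> \<open>Divide \<open>n\<close> by \<open>m\<close> with remainder; the constant
      absorbs \<open>u\<close> of every remainder.\<close>
    have "a n \<le> exp (\<Sum>r<m. u r) * exp (s * real n)" for n
    proof -
      have "real (n div m) * u m \<le> real (n div m) * (s * real m)"
        using m by (intro mult_left_mono) (simp_all add: field_simps)
      also have "\<dots> = s * real (n div m * m)" by simp
      also have "\<dots> \<le> s * real n" using s0 by (intro mult_left_mono) (auto simp flip: of_nat_mult)
      finally have 1: "real (n div m) * u m \<le> s * real n" .
      have 2: "u (n mod m) \<le> (\<Sum>r<m. u r)" using m(1) u0 by (intro member_le_sum) auto
      have "a n \<le> C * a n" using C1 a1[of n] by simp
      also have "\<dots> = exp (u (n div m * m + n mod m))" by (simp add: expu)
      also have "\<dots> \<le> exp ((\<Sum>r<m. u r) + s * real n)"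
        using umul[of "n div m" m "n mod m"] 1 2 by (simp only: exp_le_cancel_iff)
      finally show ?thesis by (simp add: exp_add)
    qed
    then show "\<exists>c. \<forall>n. a n \<le> c * exp (s * real n)" by blast
  qed
qed

text \<open>For given \<open>n\<close>, choose \<open>m\<close> so large that at least
  \<open>c / 2 * exp (\<sigma> * real m)\<close> elements of length at most \<open>m\<close> are
  new. Each has weight at least \<open>exp (- \<sigma> * real m)\<close>, so the sum grows by
  \<open>c / 2\<close>, and this can be repeated.\<close>

lemma exp_sum_diverges:
  fixes l :: "'c \<Rightarrow> real"
  assumes fin: "\<And>n::nat. finite {x \<in> X. l x \<le> real n}" and "0 < \<sigma>" "0 < c"
    and growth: "\<And>n::nat. c * exp (\<sigma> * real n) \<le> real (card {x \<in> X. l x \<le> real n})"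
  shows "\<exists>n::nat. T \<le> (\<Sum>x\<in>{x \<in> X. l x \<le> real n}. exp (- \<sigma> * l x))"
proof -
  define S where "S n = {x \<in> X. l x \<le> real n}" for n :: nat
  have finS: "finite (S n)" for n using fin by (simp add: S_def)
  have "\<exists>n. real j * (c / 2) \<le> (\<Sum>x\<in>S n. exp (- \<sigma> * l x))" for j
  proof (induction j)
    case 0
    then show ?case by (simp add: sum_nonneg)
  next
    case (Suc j)
    then obtain n where n: "real j * (c / 2) \<le> (\<Sum>x\<in>S n. exp (- \<sigma> * l x))" by blast
    obtain k :: nat where k: "2 * real (card (S n)) / (c * \<sigma>) < real k" using reals_Archimedean2 by blast
    define m where "m = max n k"
    have "2 * real (card (S n)) < c * \<sigma> * real k" using k assms by (simp add: field_simps)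
    also have "\<dots> \<le> c * (\<sigma> * real m)" using assms by (simp add: m_def)
    also have "\<dots> \<le> c * exp (\<sigma> * real m)" using assms exp_ge_add_one_self[of "\<sigma> * real m"]
      by (intro mult_left_mono) linarith+
    finally have big: "2 * real (card (S n)) \<le> c * exp (\<sigma> * real m)" by simp
    have sub: "S n \<subseteq> S m" by (auto simp: S_def m_def)
    have "real (card (S m - S n)) = real (card (S m)) - real (card (S n))"
      using card_Diff_subset[OF finS sub] card_mono[OF finS sub] by simp
    then have "c / 2 * exp (\<sigma> * real m) \<le> real (card (S m - S n))"
      using growth[of m] big unfolding S_def[symmetric] by simp
    then have "c / 2 * exp (\<sigma> * real m) * exp (- \<sigma> * real m) \<le> real (card (S m - S n)) * exp (- \<sigma> * real m)"
      by (intro mult_right_mono) auto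
    then have "c / 2 \<le> real (card (S m - S n)) * exp (- \<sigma> * real m)" by (simp add: exp_minus field_simps)
    also have "\<dots> \<le> (\<Sum>x\<in>S m - S n. exp (- \<sigma> * l x))"
      using assms by (intro sum_bounded_below) (auto simp: S_def)
    finally have "real (Suc j) * (c / 2) \<le> (\<Sum>x\<in>S m - S n. exp (- \<sigma> * l x)) + (\<Sum>x\<in>S n. exp (- \<sigma> * l x))"
      using n by (simp add: algebra_simps)
    also have "\<dots> = (\<Sum>x\<in>S m. exp (- \<sigma> * l x))" by (rule sum.subset_diff[OF sub finS, symmetric])
    finally show ?case by blast
  qed
  moreover obtain j :: nat where "T / (c / 2) < real j" using reals_Archimedean2 by blast
  then have "T \<le> real j * (c / 2)" using assms by (simp add: field_simps)
  ultimately show ?thesis unfolding S_def by (meson order_trans)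
qed

text \<open>The greedy choice: an element is kept unless one already kept is related to it.\<close>

lemma separated_subset:
  assumes "finite B" and refl: "\<And>x. P x x" and sym: "\<And>x y. P x y \<Longrightarrow> P y x"
  obtains B' where "B' \<subseteq> B" "\<And>x y. \<lbrakk>x \<in> B'; y \<in> B'; P x y\<rbrakk> \<Longrightarrow> x = y" "\<And>x. x \<in> B \<Longrightarrow> \<exists>y\<in>B'. P y x"
proof -
  have "\<exists>B'\<subseteq>B. (\<forall>x\<in>B'. \<forall>y\<in>B'. P x y \<longrightarrow> x = y) \<and> (\<forall>x\<in>B. \<exists>y\<in>B'. P y x)"
    using assms(1)
  proof (induction B)
    case (insert z B)
    then obtain B' where B': "B' \<subseteq> B" "\<forall>x\<in>B'. \<forall>y\<in>B'. P x y \<longrightarrow> x = y" "\<forall>x\<in>B. \<exists>y\<in>B'. P y x" by blast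
    show ?case
    proof (cases "\<exists>y\<in>B'. P y z")
      case True
      then show ?thesis using B' by (intro exI[of _ B']) blast
    next
      case False
      show ?thesis
      proof (intro exI[of _ "insert z B'"] conjI)
        show "insert z B' \<subseteq> insert z B" using B'(1) by blast
        show "\<forall>x\<in>insert z B'. \<forall>y\<in>insert z B'. P x y \<longrightarrow> x = y" using B'(2) False sym by blast
        show "\<forall>x\<in>insert z B. \<exists>y\<in>insert z B'. P y x" using B'(3) refl by blast
      qed
    qed
  qed simp
  then show ?thesis using that by metis
qed

lemma sum_word_weights:
  fixes g :: "'c \<Rightarrow> real"
  assumes "finite B"
  shows "(\<Sum>w\<in>{w. set w \<subseteq> B \<and> length w = k}. prod_list (map g w)) = (\<Sum>b\<in>B. g b) ^ k"
proof (induction k)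
  case 0
  have "{w. set w \<subseteq> B \<and> length w = 0} = {[]}" by auto
  then show ?case by simp
next
  case (Suc k)
  let ?W = "{w. set w \<subseteq> B \<and> length w = k}"
  have "(\<Sum>w\<in>{w. set w \<subseteq> B \<and> length w = Suc k}. prod_list (map g w))
      = (\<Sum>p\<in>?W \<times> B. prod_list (map g (snd p # fst p)))"
    unfolding lists_length_Suc_eq by (subst sum.reindex) (auto simp: inj_on_def case_prod_beta)
  also have "\<dots> = (\<Sum>w\<in>?W. \<Sum>b\<in>B. g b * prod_list (map g w))"
    by (simp add: sum.cartesian_product case_prod_beta)
  also have "\<dots> = (\<Sum>b\<in>B. g b) * (\<Sum>w\<in>?W. prod_list (map g w))"
    by (simp add: sum_distrib_left sum_distrib_right)
  finally show ?case by (simp add: Suc)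
qed

section \<open>Exponential weights and the growth of free words\<close>

context contracting_group begin

text \<open>Group elements are counted here; \<open>ball_card_le_orbit\<close> passes to points of
  the orbit.\<close>

definition ball_card :: "nat \<Rightarrow> nat" where
  "ball_card n = card {g \<in> carrier G. d \<one> g \<le> real n}"

text \<open>Sort by the integer part of the length: each shell of width 1 contributes at most
  \<open>c * exp s\<close>, so the bound is only linear in \<open>m\<close>.\<close>

lemma exp_sum_le:
  assumes T: "finite T" "T \<subseteq> carrier G" "\<And>g. g \<in> T \<Longrightarrow> d \<one> g < real m"
    and s: "0 \<le> s" and c: "\<And>n. real (ball_card n) \<le> c * exp (s * real n)"
  shows "(\<Sum>g\<in>T. exp (- s * d \<one> g)) \<le> real m * (c * exp s)"
proof -
  have "(\<Sum>g\<in>T. exp (- s * d \<one> g)) = (\<Sum>n<m. \<Sum>g\<in>{g \<in> T. nat \<lfloor>d \<one> g\<rfloor> = n}. exp (- s * d \<one> g))"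
  proof (rule sum.group[symmetric])
    show "(\<lambda>g. nat \<lfloor>d \<one> g\<rfloor>) ` T \<subseteq> {..<m}"
    proof (clarsimp)
      fix g assume "g \<in> T"
      then have "d \<one> g < real m" by (rule T(3))
      then show "nat \<lfloor>d \<one> g\<rfloor> < m" using zero_le_dist[of "pt \<one>" "pt g"] by linarith
    qed
  qed (use T in auto)
  also have "\<dots> \<le> (\<Sum>n<m. c * exp s)"
  proof (rule sum_mono)
    fix n
    let ?T = "{g \<in> T. nat \<lfloor>d \<one> g\<rfloor> = n}"
    have fl: "real n \<le> d \<one> g" "d \<one> g \<le> real (Suc n)" if "g \<in> ?T" for g
    proof -
      have "real n = of_int \<lfloor>d \<one> g\<rfloor>" using that by (auto simp: of_nat_nat)
      then show "real n \<le> d \<one> g" "d \<one> g \<le> real (Suc n)" by linarith+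
    qed
    have "(\<Sum>g\<in>?T. exp (- s * d \<one> g)) \<le> real (card ?T) * exp (- s * real n)"
      using fl s by (intro sum_bounded_above) (auto intro!: mult_left_mono)
    also have "card ?T \<le> ball_card (Suc n)"
      unfolding ball_card_def using fl T(2) by (intro card_mono finite_ball) force
    then have "real (card ?T) * exp (- s * real n) \<le> (c * exp (s * real (Suc n))) * exp (- s * real n)"
      using c[of "Suc n"] by (intro mult_right_mono) auto
    also have "exp (s * real (Suc n)) = exp s * exp (s * real n)" by (simp add: algebra_simps flip: exp_add)
    then have "c * exp (s * real (Suc n)) * exp (- s * real n) = c * exp s" by (simp add: exp_minus)
    finally show "(\<Sum>g\<in>?T. exp (- s * d \<one> g)) \<le> c * exp s" .
  qed
  finally show ?thesis by simp
qed

text \<open>The sum of weights is continuous in the exponent, so it still exceeds 1 at some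
  \<open>s > \<sigma>\<close>; this is where strictness comes from. Words of length \<open>k\<close>
  have distinct values, so their total weight is at least the \<open>k\<close>-th power of that sum.
  If balls grew no faster than \<open>exp (s * real n)\<close>, \<open>exp_sum_le\<close> would
  bound it linearly in \<open>k\<close>.\<close>

lemma free_words_growth:
  assumes B: "finite B" "\<And>b. b \<in> B \<Longrightarrow> u b \<in> carrier G"
    and inj: "\<And>k. inj_on (word_prod u) {w. set w \<subseteq> B \<and> length w = k}"
    and \<sigma>: "0 \<le> \<sigma>" and sum: "1 < (\<Sum>b\<in>B. exp (- \<sigma> * d \<one> (u b)))"
  shows "\<exists>s>\<sigma>. \<forall>c. \<exists>n. c * exp (s * real n) < real (ball_card n)"
proof -
  define q where "q s = (\<Sum>b\<in>B. exp (- s * d \<one> (u b)))" for s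
  have "(q \<longlongrightarrow> q \<sigma>) (at_right \<sigma>)" unfolding q_def by (intro tendsto_intros)
  then have "eventually (\<lambda>s. 1 < q s) (at_right \<sigma>)" using sum order_tendstoD(1)[of q "q \<sigma>" _ 1] by (simp add: q_def[of \<sigma>])
  moreover have "eventually (\<lambda>s. \<sigma> < s) (at_right \<sigma>)" by (rule eventually_at_right_less)
  ultimately have "eventually (\<lambda>s. 1 < q s \<and> \<sigma> < s) (at_right \<sigma>)" by eventually_elim simp
  then obtain s where s: "1 < q s" "\<sigma> < s" using eventually_happens'[OF trivial_limit_at_right_real] by blast
  show ?thesis
  proof (rule exI[of _ s], intro conjI allI)
    fix c
    show "\<exists>n. c * exp (s * real n) < real (ball_card n)"
    proof (rule ccontr)
      assume "\<not> ?thesis"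
      then have c: "real (ball_card n) \<le> c * exp (s * real n)" for n by (meson linorder_not_less)
      obtain M :: nat where "(\<Sum>b\<in>B. d \<one> (u b)) < real M" using reals_Archimedean2 by blast
      then have M: "d \<one> (u b) \<le> real M" if "b \<in> B" for b
        using member_le_sum[of b B "\<lambda>b. d \<one> (u b)"] that B(1) by simp
      have bound: "q s ^ k \<le> real (k * M + 1) * (c * exp s)" for k
      proof -
        let ?W = "{w. set w \<subseteq> B \<and> length w = k}"
        have cl: "word_prod u w \<in> carrier G" if "set w \<subseteq> B" for w
          by (rule word_prod_closed[OF B(2) that])
        have len: "d \<one> (word_prod u w) \<le> real (length w * M)" if "set w \<subseteq> B" for w
          using that
        proof (induction w)
          case (Cons b w)
          then show ?case using d_one_mult[of "u b" "word_prod u w"] B(2) cl M[of b] by (simp add: algebra_simps)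
        qed simp
        have weight: "prod_list (map (\<lambda>b. exp (- s * d \<one> (u b))) w) \<le> exp (- s * d \<one> (word_prod u w))"
          if "set w \<subseteq> B" for w using that
        proof (induction w)
          case (Cons b w)
          have "exp (- s * d \<one> (u b)) * prod_list (map (\<lambda>b. exp (- s * d \<one> (u b))) w)
              \<le> exp (- s * d \<one> (u b)) * exp (- s * d \<one> (word_prod u w))"
            using Cons by (intro mult_left_mono) auto
          also have "\<dots> = exp (- (s * (d \<one> (u b) + d \<one> (word_prod u w))))"
            by (simp add: exp_add[symmetric] algebra_simps)
          also have "\<dots> \<le> exp (- (s * d \<one> (word_prod u (b # w))))"
            using d_one_mult[of "u b" "word_prod u w"] B(2) cl Cons.prems s \<sigma> by (simp add: mult_left_mono)
          finally show ?case by simp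
        qed simp
        have "q s ^ k \<le> (\<Sum>w\<in>?W. exp (- s * d \<one> (word_prod u w)))"
          unfolding q_def sum_word_weights[OF B(1), symmetric] by (rule sum_mono) (use weight in auto)
        also have "\<dots> = (\<Sum>g\<in>word_prod u ` ?W. exp (- s * d \<one> g))" by (simp add: sum.reindex[OF inj])
        also have "\<dots> \<le> real (k * M + 1) * (c * exp s)"
        proof (rule exp_sum_le[OF _ _ _ _ c])
          show "finite (word_prod u ` ?W)" using finite_lists_length_eq[OF B(1)] by simp
          show "word_prod u ` ?W \<subseteq> carrier G" using cl by auto
          show "0 \<le> s" using s \<sigma> by simp
          fix g assume "g \<in> word_prod u ` ?W"
          then obtain w where "set w \<subseteq> B" "length w = k" "g = word_prod u w" by blast
          then show "d \<one> g < real (k * M + 1)" using len[of w] by simp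
        qed
        finally show ?thesis .
      qed
      have "(\<lambda>k. (real k / q s ^ k) * (real M * (c * exp s)) + (c * exp s) * (1 / q s) ^ k)
          \<longlonglongrightarrow> 0 * (real M * (c * exp s)) + (c * exp s) * 0"
        using s(1) by (intro tendsto_intros lim_n_over_pown LIMSEQ_power_zero) auto
      then have "eventually (\<lambda>k. (real k / q s ^ k) * (real M * (c * exp s)) + (c * exp s) * (1 / q s) ^ k < 1) sequentially"
        by (intro order_tendstoD) auto
      then obtain k where k: "(real k / q s ^ k) * (real M * (c * exp s)) + (c * exp s) * (1 / q s) ^ k < 1"
        by (auto simp: eventually_sequentially)
      have "(real k / q s ^ k) * (real M * (c * exp s)) + (c * exp s) * (1 / q s) ^ k
          = real (k * M + 1) * (c * exp s) / q s ^ k"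
        using s(1) by (simp add: field_simps power_one_over)
      then show False using k bound[of k] s(1) by (simp add: field_simps)
    qed
  qed (rule s)
qed

end

lemma weighted_pigeonhole:
  fixes w :: "'c \<Rightarrow> real"
  assumes "finite X" "finite Y" "k ` X \<subseteq> Y" "real (card Y) * T < sum w X" "0 \<le> T"
  shows "\<exists>y\<in>Y. T < sum w {x \<in> X. k x = y}"
proof (rule ccontr)
  assume "\<not> ?thesis"
  then have "(\<Sum>y\<in>Y. sum w {x \<in> X. k x = y}) \<le> real (card Y) * T"
    by (intro sum_bounded_above) (auto simp: not_less)
  then show False using assms by (simp add: sum.group)
qed

section \<open>Shortest coset representatives\<close>

context contracting_group begin

text \<open>Finiteness of balls makes the minimum attained. The length of the representative is the
  distance in the quotient from the base orbit to its translate.\<close>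

definition coset_rep :: "'a set \<Rightarrow> 'a" where
  "coset_rep C = (SOME a. a \<in> C \<and> (\<forall>c\<in>C. d \<one> a \<le> d \<one> c))"

definition coset_card :: "'a set \<Rightarrow> nat \<Rightarrow> nat" where
  "coset_card \<Gamma> n = card {C \<in> rcosets \<Gamma>. d \<one> (coset_rep C) \<le> real n}"

lemma coset_rep:
  assumes "subgroup \<Gamma> G" "C \<in> rcosets \<Gamma>"
  shows "coset_rep C \<in> C" "\<And>c. c \<in> C \<Longrightarrow> d \<one> (coset_rep C) \<le> d \<one> c"
    "coset_rep C \<in> carrier G" "C = \<Gamma> #> coset_rep C"
proof -
  have sub: "C \<subseteq> carrier G" using rcosets_part_G[OF assms(1)] assms(2) by blast
  obtain c where c: "c \<in> C" using subgroup.rcosets_non_empty[OF assms] by blast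
  let ?F = "{g \<in> carrier G. d \<one> g \<le> d \<one> c} \<inter> C"
  have "finite ?F" using finite_ball by blast
  moreover have "c \<in> ?F" using c sub by auto
  ultimately obtain a where "is_arg_min (d \<one>) (\<lambda>x. x \<in> ?F) a"
    using ex_is_arg_min_if_finite[of ?F "d \<one>"] by blast
  then have a: "a \<in> ?F" "\<And>x. x \<in> ?F \<Longrightarrow> d \<one> a \<le> d \<one> x" unfolding is_arg_min_linorder by blast+
  have "d \<one> a \<le> d \<one> x" if "x \<in> C" for x
  proof (cases "d \<one> x \<le> d \<one> c")
    case True
    then show ?thesis using a(2) that sub by blast
  next
    case False
    then show ?thesis using a(1) by simp
  qed
  then have "a \<in> C \<and> (\<forall>x\<in>C. d \<one> a \<le> d \<one> x)" using a by blast
  then have *: "coset_rep C \<in> C \<and> (\<forall>x\<in>C. d \<one> (coset_rep C) \<le> d \<one> x)"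
    unfolding coset_rep_def by (rule someI)
  show r: "coset_rep C \<in> C" "\<And>c. c \<in> C \<Longrightarrow> d \<one> (coset_rep C) \<le> d \<one> c" using * by blast+
  show "coset_rep C \<in> carrier G" using r sub by blast
  obtain g where g: "g \<in> carrier G" "C = \<Gamma> #> g" using assms(2) by (auto simp: RCOSETS_def)
  then show "C = \<Gamma> #> coset_rep C" using repr_independence[of "coset_rep C" \<Gamma> g] r assms(1) by simp
qed

lemma coset_rep_inj: "subgroup \<Gamma> G \<Longrightarrow> inj_on coset_rep (rcosets \<Gamma>)"
  using coset_rep(4) by (intro inj_onI) metis

lemma finite_short_cosets:
  assumes "subgroup \<Gamma> G"
  shows "finite {C \<in> rcosets \<Gamma>. d \<one> (coset_rep C) \<le> r}"
proof (rule finite_imageD)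
  show "finite (coset_rep ` {C \<in> rcosets \<Gamma>. d \<one> (coset_rep C) \<le> r})"
    by (rule finite_subset[OF _ finite_ball[of r]]) (use coset_rep(3)[OF assms] in auto)
  show "inj_on coset_rep {C \<in> rcosets \<Gamma>. d \<one> (coset_rep C) \<le> r}"
    using coset_rep_inj[OF assms] by (rule inj_on_subset) blast
qed

lemma coset_card_mono: "subgroup \<Gamma> G \<Longrightarrow> n \<le> m \<Longrightarrow> coset_card \<Gamma> n \<le> coset_card \<Gamma> m"
  unfolding coset_card_def by (intro card_mono finite_short_cosets) auto

lemma coset_card_pos:
  assumes "subgroup \<Gamma> G" shows "1 \<le> coset_card \<Gamma> n"
proof -
  have C: "\<Gamma> #> \<one> \<in> rcosets \<Gamma>" using rcosetsI[OF subgroup.subset[OF assms]] by simp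
  have "d \<one> (coset_rep (\<Gamma> #> \<one>)) \<le> d \<one> \<one>"
    by (rule coset_rep(2)[OF assms C]) (rule rcos_self[OF _ assms], simp)
  then have "{C \<in> rcosets \<Gamma>. d \<one> (coset_rep C) \<le> real n} \<noteq> {}" using C by auto
  then show ?thesis unfolding coset_card_def using finite_short_cosets[OF assms]
    by (simp add: Suc_le_eq card_gt_0_iff)
qed

text \<open>Cut a shortest representative \<open>g\<close> at an intermediate \<open>a\<close>: its
  coset is the product of the cosets of \<open>a\<close> and \<open>inv a \<otimes> g\<close>. Hence
  pairs of short cosets map onto the cosets counted on the left.\<close>

lemma coset_card_split:
  assumes N: "\<Gamma> \<lhd> G" and r: "R \<le> real r" and p: "p + 2 * r \<le> p1 + p2" "r \<le> p1" "r \<le> p2"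
  shows "coset_card \<Gamma> p \<le> coset_card \<Gamma> p1 * coset_card \<Gamma> p2"
proof -
  interpret N: normal \<Gamma> G by fact
  have sg: "subgroup \<Gamma> G" by (rule N.subgroup_axioms)
  define S where "S n = {C \<in> rcosets \<Gamma>. d \<one> (coset_rep C) \<le> real n}" for n
  have fin: "finite (S n)" for n unfolding S_def by (rule finite_short_cosets[OF sg])
  have mem: "\<Gamma> #> a \<in> S n" if "a \<in> carrier G" "d \<one> a \<le> real n" for a n
    using coset_rep(2)[OF sg rcosetsI[OF N.subset that(1)] rcos_self[OF that(1) sg]]
      that rcosetsI[OF N.subset that(1)] by (simp add: S_def)
  have "S p \<subseteq> (\<lambda>(C1, C2). C1 <#> C2) ` (S p1 \<times> S p2)"
  proof
    fix C assume "C \<in> S p"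
    then have C: "C \<in> rcosets \<Gamma>" "d \<one> (coset_rep C) \<le> real p" by (auto simp: S_def)
    define g where "g = coset_rep C"
    have g: "g \<in> carrier G" "C = \<Gamma> #> g" using coset_rep[OF sg C(1)] by (auto simp: g_def)
    \<comment> \<open>Cutting \<open>r\<close> early leaves room for the error \<open>R\<close> in
      the first radius; the minimum covers representatives shorter than that.\<close>
    define t where "t = min (d \<one> g) (real p1 - real r)"
    have "0 \<le> t" "t \<le> d \<one> g" using p by (auto simp: t_def)
    then obtain a where a: "a \<in> carrier G" "d \<one> a \<le> t + R" "d a g \<le> d \<one> g - t + R"
      using between[of \<one> g t] g by auto
    have "d \<one> a \<le> real p1" using a(2) r by (simp add: t_def)
    moreover have "d \<one> (inv a \<otimes> g) \<le> real p2"
    proof -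
      have "real p + 2 * real r \<le> real p1 + real p2" using p(1) by linarith
      then have "d a g \<le> real p2" using a(3) r p C(2) unfolding g_def[symmetric] by (simp add: t_def min_def split: if_splits)
      then show ?thesis using d_inv[of g \<one> a] a g by (simp add: dist_commute)
    qed
    moreover have "C = (\<Gamma> #> a) <#> (\<Gamma> #> (inv a \<otimes> g))"
      using a g by (simp add: N.rcos_sum m_assoc[symmetric])
    ultimately show "C \<in> (\<lambda>(C1, C2). C1 <#> C2) ` (S p1 \<times> S p2)"
      using mem a(1) g(1) by (intro image_eqI[of _ _ "(\<Gamma> #> a, \<Gamma> #> (inv a \<otimes> g))"]) auto
  qed
  then have "card (S p) \<le> card (S p1 \<times> S p2)" using fin by (intro surj_card_le) auto
  then show ?thesis by (simp add: coset_card_def S_def card_cartesian_product)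
qed

text \<open>\<open>coset_card_split\<close> loses \<open>2 * r\<close>, so \<open>n + m\<close> is
  split into the radii \<open>n + r\<close> and \<open>m + r\<close>. Each surplus \<open>r\<close>
  is then removed by another split, with radii \<open>n\<close> and \<open>3 * r\<close>, at the
  cost of a constant factor.\<close>

lemma coset_card_submultiplicative:
  assumes "\<Gamma> \<lhd> G"
  shows "\<exists>C\<ge>1. \<forall>n m. real (coset_card \<Gamma> (n + m)) \<le> C * real (coset_card \<Gamma> n) * real (coset_card \<Gamma> m)"
proof -
  have sg: "subgroup \<Gamma> G" using assms by (rule normal_imp_subgroup)
  obtain r where r: "R \<le> real r" using real_arch_simple by blast
  let ?c = "coset_card \<Gamma>"
  have shift: "?c (n + r) \<le> ?c n * ?c (3 * r)" for n
  proof (cases "r \<le> n")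
    case True
    then show ?thesis using r by (intro coset_card_split[OF assms]) auto
  next
    case False
    have "?c (n + r) \<le> ?c (3 * r)" using False by (intro coset_card_mono[OF sg]) simp
    also have "\<dots> \<le> ?c n * ?c (3 * r)" using coset_card_pos[OF sg, of n] by simp
    finally show ?thesis .
  qed
  have "?c (n + m) \<le> (?c (3 * r) * ?c (3 * r)) * ?c n * ?c m" for n m
  proof -
    have "?c (n + m) \<le> ?c (n + r) * ?c (m + r)" using r by (intro coset_card_split[OF assms]) auto
    also have "\<dots> \<le> (?c n * ?c (3 * r)) * (?c m * ?c (3 * r))" by (intro mult_le_mono shift)
    finally show ?thesis by (simp add: mult_ac)
  qed
  then have "real (?c (n + m)) \<le> real (?c (3 * r) * ?c (3 * r)) * real (?c n) * real (?c m)" for n m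
    by (simp only: of_nat_mult[symmetric] of_nat_le_iff)
  moreover have "1 \<le> real (?c (3 * r) * ?c (3 * r))"
    using mult_le_mono[OF coset_card_pos[OF sg] coset_card_pos[OF sg], of "3 * r" "3 * r"] by linarith
  ultimately show ?thesis by blast
qed

text \<open>Elements of \<open>E\<close> stay at bounded distance from
  \<open>\<langle>h\<rangle>\<close>, so a bounded projection puts them in a finite ball.\<close>

lemma finite_E_near: "finite {g \<in> E. d \<one> (pr g) \<le> D}"
proof -
  obtain S where S: "finite S" "S \<subseteq> carrier G" "E \<subseteq> {H i \<otimes> s | i s. s \<in> S}" by (rule E_finite_index)
  have "finite (d \<one> ` S)" using S by simp
  then obtain M where M: "\<And>x. x \<in> d \<one> ` S \<Longrightarrow> x \<le> M" by (meson bdd_above_finite bdd_above.E)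
  have "{g \<in> E. d \<one> (pr g) \<le> D} \<subseteq> {g \<in> carrier G. d \<one> g \<le> D + M + K}"
  proof
    fix g assume g: "g \<in> {g \<in> E. d \<one> (pr g) \<le> D}"
    then obtain i s where s: "s \<in> S" "g = H i \<otimes> s" using S by blast
    have gc: "g \<in> carrier G" using g E_carrier by blast
    have "d g (H i) = d \<one> s" using d_right[of "H i" s] s S by (simp add: subsetD dist_commute)
    then have "d g (pr g) \<le> M + K" using pr_near[OF gc, of i] M s by fastforce
    then show "g \<in> {g \<in> carrier G. d \<one> g \<le> D + M + K}"
      using g gc dist_triangle[of "pt \<one>" "pt g" "pt (pr g)"] by (simp add: dist_commute)
  qed
  then show ?thesis using finite_ball finite_subset by blast
qed

text \<open>A normal subgroup meets the complement of \<open>E\<close>, so conjugating shortest coset representatives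
  into general position and inserting \<open>f\<close> between them gives free words in \<open>G\<close>.\<close>

lemma free_words_from_cosets:
  assumes ne: "\<not> elementary_group G" and N: "\<Gamma> \<lhd> G" and inf: "infinite \<Gamma>"
    and \<sigma>: "0 < \<sigma>" and div: "\<And>T. \<exists>n::nat. T \<le> (\<Sum>C\<in>{C \<in> rcosets \<Gamma>. d \<one> (coset_rep C) \<le> real n}. exp (- \<sigma> * d \<one> (coset_rep C)))"
  shows "\<exists>B f. finite B \<and> B \<subseteq> carrier G \<and> f \<in> carrier G \<and>
    (\<forall>k. inj_on (word_prod (\<lambda>b. b \<otimes> f)) {w. set w \<subseteq> B \<and> length w = k}) \<and>
    1 < (\<Sum>b\<in>B. exp (- \<sigma> * d \<one> (b \<otimes> f)))"
proof -
  interpret N: normal \<Gamma> G by fact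
  have sg: "subgroup \<Gamma> G" by (rule N.subgroup_axioms)
  obtain \<gamma> where \<gamma>: "\<gamma> \<in> \<Gamma>" "\<gamma> \<notin> E" using normal_not_in_E[OF ne N inf] by blast
  obtain Ks D0 where Ks: "finite Ks" "Ks \<subseteq> carrier G" and sel: "\<And>g. g \<in> carrier G \<Longrightarrow>
      \<exists>k\<in>Ks. d \<one> (pr (inv k \<otimes> g \<otimes> k)) \<le> D0 \<and> d \<one> (pr (inv k \<otimes> inv g \<otimes> k)) \<le> D0"
    using conjugator_selection[OF ne] by blast
  have Ksne: "Ks \<noteq> {}" using sel[of \<one>] by auto
  obtain C where C0: "0 \<le> C" and C: "\<And>g y. \<lbrakk>g \<in> carrier G - E; y \<in> carrier G; C < d (pr y) (pr (inv g))\<rbrakk> \<Longrightarrow> d (pr (g \<otimes> y)) (pr g) \<le> C"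
    using step by blast
  define M where "M = (\<Sum>k\<in>Ks. d \<one> k)"
  have M: "d \<one> k \<le> M" if "k \<in> Ks" for k unfolding M_def using Ks that by (intro member_le_sum) auto
  have M0: "0 \<le> M" unfolding M_def by (simp add: sum_nonneg)
  define D where "D = max D0 0"
  obtain n where n: "n > 0" "\<And>m. n \<le> \<bar>m\<bar> \<Longrightarrow> 100 * (C + D + K + d \<one> (pr \<gamma>) + d \<one> (pr (inv \<gamma>))) + 4 * M < d \<one> (H m)"
    using H_far by blast
  interpret barrier G pt h pr K R \<gamma> n C D "4 * M"
    by unfold_locales (use C0 C \<gamma> M0 n(2)[of n] N.subset in \<open>auto simp: D_def\<close>)
  define \<rho> where "\<rho> = 2 * d \<one> f + 50 * Q"
  have \<rho>0: "0 \<le> \<rho>" using Q_bounds(6) by (simp add: \<rho>_def)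
  define V where "V = real (card {g \<in> carrier G. d \<one> g \<le> \<rho>})"
  have V1: "1 \<le> V"
  proof -
    have "\<one> \<in> {g \<in> carrier G. d \<one> g \<le> \<rho>}" using \<rho>0 by simp
    then have "0 < card {g \<in> carrier G. d \<one> g \<le> \<rho>}" using finite_ball by (auto simp: card_gt_0_iff)
    then show ?thesis by (simp add: V_def)
  qed
  define cE where "cE = real (card {g \<in> E. d \<one> (pr g) \<le> D})"
  have cE0: "0 \<le> cE" by (simp add: cE_def)
  define wt where "wt g = exp (- \<sigma> * d \<one> g)" for g
  have wt0: "0 \<le> wt g" "wt g \<le> 1" for g using \<sigma> by (simp_all add: wt_def)
  \<comment> \<open>The weight must survive four later losses: \<open>cE\<close> for letters in
    \<open>E\<close>, \<open>V * exp (\<sigma> * \<rho>)\<close> for separation,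
    \<open>exp (\<sigma> * d \<one> f)\<close> for inserting \<open>f\<close>, and in
    \<open>T\<close> the factor for conjugation. None of them depends on the radius \<open>m\<close>
    chosen next.\<close>
  define T1 where "T1 = exp (\<sigma> * d \<one> f) * (V * exp (\<sigma> * \<rho>)) + cE"
  have T10: "0 \<le> T1" using V1 cE0 by (simp add: T1_def)
  define T where "T = exp (2 * \<sigma> * M) * T1"
  obtain m :: nat where m: "real (card Ks) * T + 1 \<le> (\<Sum>C\<in>{C \<in> rcosets \<Gamma>. d \<one> (coset_rep C) \<le> real m}. wt (coset_rep C))"
    unfolding wt_def using div by blast
  define \<C> where "\<C> = {C \<in> rcosets \<Gamma>. d \<one> (coset_rep C) \<le> real m}"
  have \<C>fin: "finite \<C>" unfolding \<C>_def by (rule finite_short_cosets[OF sg])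
  have rep: "coset_rep c \<in> carrier G" if "c \<in> \<C>" for c using coset_rep(3)[OF sg] that by (auto simp: \<C>_def)
  have "\<forall>c\<in>\<C>. \<exists>k. k \<in> Ks \<and> d \<one> (pr (inv k \<otimes> coset_rep c \<otimes> k)) \<le> D0 \<and> d \<one> (pr (inv k \<otimes> inv (coset_rep c) \<otimes> k)) \<le> D0"
    using sel rep by blast
  from bchoice[OF this] obtain \<kappa> where \<kappa>: "\<And>c. c \<in> \<C> \<Longrightarrow> \<kappa> c \<in> Ks"
    "\<And>c. c \<in> \<C> \<Longrightarrow> d \<one> (pr (inv (\<kappa> c) \<otimes> coset_rep c \<otimes> \<kappa> c)) \<le> D0"
    "\<And>c. c \<in> \<C> \<Longrightarrow> d \<one> (pr (inv (\<kappa> c) \<otimes> inv (coset_rep c) \<otimes> \<kappa> c)) \<le> D0" by blast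
  \<comment> \<open>A single conjugator for all letters makes conjugation injective on the
    representatives; pigeonhole keeps weight more than \<open>T\<close>.\<close>
  obtain k where k: "k \<in> Ks" "T < (\<Sum>c\<in>{c \<in> \<C>. \<kappa> c = k}. wt (coset_rep c))"
    using weighted_pigeonhole[OF \<C>fin Ks(1), of \<kappa> T "\<lambda>c. wt (coset_rep c)"] \<kappa>(1) m T10
    unfolding \<C>_def[symmetric] by (auto simp: T_def)
  have kc: "k \<in> carrier G" using k Ks by blast
  define \<D> where "\<D> = {c \<in> \<C>. \<kappa> c = k}"
  define b where "b c = inv k \<otimes> coset_rep c \<otimes> k" for c
  have bc: "b c \<in> carrier G" if "c \<in> \<D>" for c using rep that kc by (simp add: b_def \<D>_def)
  have conj_len: "d \<one> (inv k \<otimes> g \<otimes> k) \<le> d \<one> g + 2 * M" if "g \<in> carrier G" for g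
    using d_one_mult[of "inv k \<otimes> g" k] d_one_mult[of "inv k" g] d_inv_one[OF kc] M[OF k(1)] kc that by simp
  have b_len: "d \<one> (b c) \<le> d \<one> (coset_rep c) + 2 * M" if "c \<in> \<D>" for c
    unfolding b_def using conj_len rep that by (simp add: \<D>_def)
  have b_inj: "inj_on b \<D>"
  proof (rule inj_onI)
    fix x y assume xy: "x \<in> \<D>" "y \<in> \<D>" "b x = b y"
    then have "coset_rep x = coset_rep y" using rep kc by (simp add: b_def \<D>_def)
    then show "x = y" using inj_onD[OF coset_rep_inj[OF sg]] xy by (auto simp: \<D>_def \<C>_def)
  qed
  have b_pr: "d \<one> (pr (b c)) \<le> D" "d \<one> (pr (inv (b c))) \<le> D" if "c \<in> \<D>" for c
  proof -
    have c: "c \<in> \<C>" "\<kappa> c = k" using that by (auto simp: \<D>_def)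
    show "d \<one> (pr (b c)) \<le> D" using \<kappa>(2)[OF c(1)] c(2) by (simp add: b_def D_def)
    have "inv (b c) = inv k \<otimes> inv (coset_rep c) \<otimes> k" using rep[OF c(1)] kc by (simp add: b_def inv_mult_group m_assoc)
    then show "d \<one> (pr (inv (b c))) \<le> D" using \<kappa>(3)[OF c(1)] c(2) by (simp add: D_def)
  qed
  \<comment> \<open>Conjugation by \<open>k\<close> changes lengths by at most \<open>2 * M\<close>,
    once for the representative and once for its competitor \<open>y \<otimes> coset_rep c\<close>
    in the same coset.\<close>
  have b_min: "d \<one> (b c) \<le> d \<one> (x \<otimes> b c) + 4 * M" if "c \<in> \<D>" "x \<in> \<Gamma>" for c x
  proof -
    have c: "c \<in> rcosets \<Gamma>" "coset_rep c \<in> carrier G" using that rep by (auto simp: \<D>_def \<C>_def)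
    have xc: "x \<in> carrier G" using that N.subset by blast
    define y where "y = k \<otimes> x \<otimes> inv k"
    have y: "y \<in> \<Gamma>" "y \<in> carrier G" using N.inv_op_closed2[OF kc that(2)] N.subset by (auto simp: y_def)
    have "y \<otimes> coset_rep c \<in> c"
      using coset_rep(4)[OF sg c(1)] y unfolding r_coset_def by blast
    then have 1: "d \<one> (coset_rep c) \<le> d \<one> (y \<otimes> coset_rep c)" by (rule coset_rep(2)[OF sg c(1)])
    have e: "y \<otimes> coset_rep c = k \<otimes> (x \<otimes> b c) \<otimes> inv k"
    proof -
      have "k \<otimes> (x \<otimes> b c) \<otimes> inv k = k \<otimes> x \<otimes> inv k \<otimes> coset_rep c \<otimes> (k \<otimes> inv k)"
        unfolding b_def using xc kc c(2) by (simp only: m_assoc m_closed inv_closed)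
      then show ?thesis using xc kc c(2) by (simp add: y_def)
    qed
    have "d \<one> (y \<otimes> coset_rep c) \<le> d \<one> (x \<otimes> b c) + 2 * M"
      unfolding e using d_one_mult[of "k \<otimes> (x \<otimes> b c)" "inv k"] d_one_mult[of k "x \<otimes> b c"]
        d_inv_one[OF kc] M[OF k(1)] kc xc bc[OF that(1)] by simp
    then show ?thesis using 1 b_len[OF that(1)] by linarith
  qed
  \<comment> \<open>The discarded letters have bounded projection, so \<open>finite_E_near\<close>
    bounds their number independently of \<open>m\<close>.\<close>
  define B1 where "B1 = b ` \<D> - E"
  have \<D>fin: "finite \<D>" using \<C>fin by (simp add: \<D>_def)
  have B1fin: "finite B1" using \<D>fin by (simp add: B1_def)
  have "exp (- (2 * \<sigma> * M)) * T < exp (- (2 * \<sigma> * M)) * (\<Sum>c\<in>\<D>. wt (coset_rep c))"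
    using k(2) by (simp add: \<D>_def)
  also have "\<dots> \<le> (\<Sum>c\<in>\<D>. wt (b c))"
    unfolding sum_distrib_left
  proof (rule sum_mono)
    fix c assume "c \<in> \<D>"
    then have "\<sigma> * d \<one> (b c) \<le> \<sigma> * (d \<one> (coset_rep c) + 2 * M)" using b_len \<sigma> by simp
    then show "exp (- (2 * \<sigma> * M)) * wt (coset_rep c) \<le> wt (b c)"
      unfolding wt_def exp_add[symmetric] by (simp add: algebra_simps)
  qed
  also have "\<dots> = sum wt (b ` \<D>)" by (simp add: sum.reindex[OF b_inj])
  also have "\<dots> = sum wt (b ` \<D> \<inter> E) + sum wt B1"
    unfolding B1_def using \<D>fin by (intro sum.Int_Diff) simp
  also have "sum wt (b ` \<D> \<inter> E) \<le> cE"
  proof -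
    have "sum wt (b ` \<D> \<inter> E) \<le> real (card (b ` \<D> \<inter> E)) * 1" using wt0 by (intro sum_bounded_above) auto
    also have "\<dots> \<le> cE" unfolding cE_def using b_pr finite_E_near by (auto intro!: card_mono)
    finally show ?thesis .
  qed
  finally have "exp (- (2 * \<sigma> * M)) * T - cE < sum wt B1" by simp
  moreover have "exp (- (2 * \<sigma> * M)) * T = T1" by (simp add: T_def exp_minus)
  ultimately have big: "exp (\<sigma> * d \<one> f) * (V * exp (\<sigma> * \<rho>)) < sum wt B1" by (simp add: T1_def)
  \<comment> \<open>Every letter is within \<rho> of a retained one. At most \<open>V\<close>
    letters are charged to each retained letter, each with at most
    \<open>exp (\<sigma> * \<rho>)\<close> times its weight.\<close>
  obtain B2 where B2: "B2 \<subseteq> B1" "\<And>x y. \<lbrakk>x \<in> B2; y \<in> B2; d x y \<le> \<rho>\<rbrakk> \<Longrightarrow> x = y"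
      "\<And>x. x \<in> B1 \<Longrightarrow> \<exists>y\<in>B2. d y x \<le> \<rho>"
    by (rule separated_subset[OF B1fin, of "\<lambda>x y. d x y \<le> \<rho>"]) (use \<rho>0 in \<open>auto simp: dist_commute\<close>)
  have B2fin: "finite B2" using B2(1) B1fin finite_subset by blast
  have B1c: "B1 \<subseteq> carrier G" using bc by (auto simp: B1_def)
  have B2c: "B2 \<subseteq> carrier G" using B2 B1c by blast
  obtain \<tau> where \<tau>: "\<forall>x\<in>B1. \<tau> x \<in> B2 \<and> d (\<tau> x) x \<le> \<rho>"
    using bchoice[of B1 "\<lambda>x y. y \<in> B2 \<and> d y x \<le> \<rho>"] B2(3) by blast
  have "sum wt B1 = (\<Sum>y\<in>B2. sum wt {x \<in> B1. \<tau> x = y})"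
    using B1fin B2fin \<tau> by (intro sum.group[symmetric]) auto
  also have "\<dots> \<le> (\<Sum>y\<in>B2. sum wt {x \<in> B1. d y x \<le> \<rho>})"
    using B1fin wt0 \<tau> by (intro sum_mono sum_mono2) auto
  also have "\<dots> \<le> (\<Sum>y\<in>B2. V * exp (\<sigma> * \<rho>) * wt y)"
  proof (rule sum_mono)
    fix y assume y: "y \<in> B2"
    then have yc: "y \<in> carrier G" using B2c by blast
    let ?S = "{x \<in> B1. d y x \<le> \<rho>}"
    have "wt x \<le> exp (\<sigma> * \<rho>) * wt y" if "x \<in> ?S" for x
    proof -
      have "\<sigma> * d \<one> y \<le> \<sigma> * (d \<one> x + \<rho>)"
        using that \<sigma> dist_triangle[of "pt \<one>" "pt y" "pt x"] by (intro mult_left_mono) (auto simp: dist_commute)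
      then show ?thesis unfolding wt_def exp_add[symmetric] by (simp add: algebra_simps)
    qed
    then have "sum wt ?S \<le> real (card ?S) * (exp (\<sigma> * \<rho>) * wt y)" by (rule sum_bounded_above)
    also have "real (card ?S) \<le> V"
    proof -
      have "card ?S \<le> card {g \<in> carrier G. d y g \<le> \<rho>}"
        using B1c by (intro card_mono finite_ball_at[OF yc]) auto
      also have "\<dots> \<le> card {g \<in> carrier G. d \<one> g \<le> \<rho>}" by (rule card_ball_at[OF yc])
      finally show ?thesis by (simp add: V_def)
    qed
    then have "real (card ?S) * (exp (\<sigma> * \<rho>) * wt y) \<le> V * (exp (\<sigma> * \<rho>) * wt y)"
      using wt0 by (intro mult_right_mono) auto
    finally show "sum wt ?S \<le> V * exp (\<sigma> * \<rho>) * wt y" by (simp add: mult_ac)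
  qed
  finally have "sum wt B1 \<le> (V * exp (\<sigma> * \<rho>)) * sum wt B2" by (simp add: sum_distrib_left)
  then have "(V * exp (\<sigma> * \<rho>)) * exp (\<sigma> * d \<one> f) < (V * exp (\<sigma> * \<rho>)) * sum wt B2"
    using big by (simp add: mult_ac)
  moreover have "0 < V * exp (\<sigma> * \<rho>)" using V1 by simp
  ultimately have "exp (\<sigma> * d \<one> f) < sum wt B2" by (simp only: mult_less_cancel_left_pos)
  then have "exp (- (\<sigma> * d \<one> f)) * exp (\<sigma> * d \<one> f) < exp (- (\<sigma> * d \<one> f)) * sum wt B2" by simp
  then have "1 < (\<Sum>y\<in>B2. exp (- (\<sigma> * d \<one> f)) * wt y)" by (simp add: sum_distrib_left flip: exp_add)
  also have "\<dots> \<le> (\<Sum>y\<in>B2. exp (- \<sigma> * d \<one> (y \<otimes> f)))"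
  proof (rule sum_mono)
    fix y assume "y \<in> B2"
    then have "\<sigma> * d \<one> (y \<otimes> f) \<le> \<sigma> * (d \<one> y + d \<one> f)" using d_one_mult[of y f] B2c \<sigma> by auto
    then show "exp (- (\<sigma> * d \<one> f)) * wt y \<le> exp (- \<sigma> * d \<one> (y \<otimes> f))"
      unfolding wt_def exp_add[symmetric] by (simp add: algebra_simps)
  qed
  finally have "1 < (\<Sum>y\<in>B2. exp (- \<sigma> * d \<one> (y \<otimes> f)))" .
  moreover have "inj_on (word_prod (\<lambda>b. b \<otimes> f)) {w. set w \<subseteq> B2 \<and> length w = j}" for j
  proof (rule words_free[OF _ _ _ N \<gamma>(1)])
    show "B2 \<subseteq> carrier G - E" using B2(1) B2c by (auto simp: B1_def)
    have im: "\<exists>c\<in>\<D>. x = b c" if "x \<in> B2" for x using that B2(1) by (auto simp: B1_def)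
    show "d \<one> (pr x) \<le> D" "d \<one> (pr (inv x)) \<le> D" if "x \<in> B2" for x using im[OF that] b_pr by auto
    show "d \<one> x \<le> d \<one> (y \<otimes> x) + 4 * M" if "x \<in> B2" "y \<in> \<Gamma>" for x y using im[OF that(1)] b_min that(2) by auto
    show "x = y" if "x \<in> B2" "y \<in> B2" "d x y \<le> 2 * d \<one> f + 50 * Q" for x y
      using B2(2) that by (simp add: \<rho>_def)
  qed
  ultimately show ?thesis using B2fin B2c by (intro exI[of _ B2] exI[of _ f]) auto
qed

text \<open>Explicit exponential bounds on both sides turn directly into bounds for the two limits
  superior. The exponent \<open>s\<close> is taken strictly between the coset rate \<sigma> and
  \<open>s'\<close>, since the upper bound on cosets is available only above \<sigma>.\<close>

theorem coset_growth_gap: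
  assumes ne: "\<not> elementary_group G" and N: "\<Gamma> \<lhd> G" and inf: "infinite \<Gamma>"
  shows "\<exists>s s'. 0 \<le> s \<and> s < s' \<and> (\<exists>c. \<forall>n. real (coset_card \<Gamma> n) \<le> c * exp (s * real n)) \<and>
    (\<forall>c. \<exists>n. c * exp (s' * real n) < real (ball_card n))"
proof -
  have sg: "subgroup \<Gamma> G" using N by (rule normal_imp_subgroup)
  obtain C where C: "1 \<le> C" "\<And>n m. real (coset_card \<Gamma> (n + m)) \<le> C * real (coset_card \<Gamma> n) * real (coset_card \<Gamma> m)"
    using coset_card_submultiplicative[OF N] by blast
  have "1 \<le> real (coset_card \<Gamma> n)" for n using coset_card_pos[OF sg, of n] by simp
  then obtain \<sigma> where \<sigma>: "0 \<le> \<sigma>" and lower: "\<And>n. exp (\<sigma> * real n) \<le> C * real (coset_card \<Gamma> n)"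
    and upper: "\<And>s. \<sigma> < s \<Longrightarrow> \<exists>c. \<forall>n. real (coset_card \<Gamma> n) \<le> c * exp (s * real n)"
    using submultiplicative_rate[of "\<lambda>n. real (coset_card \<Gamma> n)" C] C by blast
  have "\<exists>s'>\<sigma>. \<forall>c. \<exists>n. c * exp (s' * real n) < real (ball_card n)"
  proof (cases "\<sigma> = 0")
    case True
    obtain \<gamma> where \<gamma>: "\<gamma> \<in> \<Gamma>" "\<gamma> \<notin> E" using normal_not_in_E[OF ne N inf] by blast
    then have \<gamma>c: "\<gamma> \<in> carrier G - E" using subgroup.subset[OF sg] by blast
    obtain n where n: "n \<noteq> 0" "\<And>k. inj_on (word_prod (\<lambda>m. H m \<otimes> \<gamma>)) {w. set w \<subseteq> {n, 2 * n} \<and> length w = k}"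
      using free_pair[OF \<gamma>c] by blast
    \<comment> \<open>At \<sigma> = 0 every weight is 1, so the two letters already have sum 2. The
      sum over cosets may converge in this case, for instance when the quotient is finite.\<close>
    show ?thesis by (rule free_words_growth[OF _ _ n(2)]) (use True \<gamma>c n(1) in auto)
  next
    case False
    then have pos: "0 < \<sigma>" using \<sigma> by simp
    have "\<exists>n::nat. T \<le> (\<Sum>C\<in>{C \<in> rcosets \<Gamma>. d \<one> (coset_rep C) \<le> real n}. exp (- \<sigma> * d \<one> (coset_rep C)))" for T
    proof (rule exp_sum_diverges[OF finite_short_cosets[OF sg] pos])
      show "0 < 1 / C" using C by simp
      show "1 / C * exp (\<sigma> * real n) \<le> real (card {x \<in> rcosets \<Gamma>. d \<one> (coset_rep x) \<le> real n})" for n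
        using lower[of n] C(1) by (simp add: coset_card_def field_simps)
    qed
    then obtain B f where "finite B" "B \<subseteq> carrier G" "f \<in> carrier G"
      "\<And>k. inj_on (word_prod (\<lambda>b. b \<otimes> f)) {w. set w \<subseteq> B \<and> length w = k}"
      "1 < (\<Sum>b\<in>B. exp (- \<sigma> * d \<one> (b \<otimes> f)))"
      using free_words_from_cosets[OF ne N inf pos] by blast
    then show ?thesis using \<sigma> by (intro free_words_growth) auto
  qed
  then obtain s' where s': "\<sigma> < s'" "\<forall>c. \<exists>n. c * exp (s' * real n) < real (ball_card n)" by blast
  obtain s where s: "\<sigma> < s" "s < s'" using dense[OF s'(1)] by blast
  show ?thesis using upper[OF s(1)] s s' \<sigma> by (intro exI[of _ s] exI[of _ s']) auto
qed

end

section \<open>From the action to the group\<close>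

lemma geodesic_sub:
  assumes "geodesic ({0..r}, p)" "0 \<le> s" "s \<le> r"
  shows "geodesic ({0..s}, p)"
  using assms by (auto simp: geodesic_def parameter_interval_def is_interval_cc)

lemma geodesic_rev:
  assumes "geodesic ({0..r}, p)"
  shows "geodesic ({0..r}, \<lambda>t. p (r - t))"
  using assms by (auto simp: geodesic_def parameter_interval_def abs_minus_commute)

lemma geodesic_dist:
  "geodesic ({0..r}, p) \<Longrightarrow> s \<in> {0..r} \<Longrightarrow> t \<in> {0..r} \<Longrightarrow> dist (p s) (p t) = \<bar>s - t\<bar>"
  by (auto simp: geodesic_def)

lemma quasigeodesic_geodesic: "geodesic q \<Longrightarrow> quasigeodesic 1 0 q"
  by (auto simp: geodesic_def quasigeodesic_def case_prod_beta)

lemma point_proj_nonempty: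
  assumes "0 < \<delta>0" "X \<noteq> {}" shows "point_proj \<delta>0 X y \<noteq> {}"
proof -
  have "infdist y X < infdist y X + \<delta>0" using assms by simp
  then have "(INF x\<in>X. dist y x) < infdist y X + \<delta>0" using assms by (simp add: infdist_def)
  then obtain x where "x \<in> X" "dist y x < infdist y X + \<delta>0"
    using cINF_less_iff[of X "dist y"] assms(2) by (auto simp: bdd_below_image_dist)
  then show ?thesis by (auto simp: point_proj_def intro: less_imp_le)
qed

text \<open>Cutting a geodesic at a point close to \<open>X\<close> leaves initial and final pieces which, before
  they come close to \<open>X\<close>, have small projections.\<close>

lemma contracting_projection:
  fixes X :: "'b::metric_space set"
  assumes \<delta>0: "0 < \<delta>0" and L: "preferred_collection L" and gs: "geodesic_space TYPE('b)"
    and contr: "contracting_set \<delta>0 L X" and X: "X \<noteq> {}"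
  shows "\<exists>K \<pi>. (\<forall>y. \<pi> y \<in> X) \<and> (\<forall>y. \<forall>x\<in>X. dist y (\<pi> y) \<le> dist y x + K) \<and>
    (\<forall>y z. K < dist (\<pi> y) (\<pi> z) \<longrightarrow>
      dist y (\<pi> y) + dist (\<pi> y) (\<pi> z) + dist (\<pi> z) z \<le> dist y z + K)"
proof -
  obtain \<mu>' \<epsilon>' where me: "\<forall>l c. 0 \<le> \<mu>' l c \<and> 0 \<le> \<epsilon>' l c"
    "\<forall>l c. \<forall>q\<in>L. quasigeodesic l c q \<and> \<mu>' l c \<le> setdist (curve_image q) X \<longrightarrow>
           bounded (set_proj \<delta>0 X (curve_image q)) \<and> diameter (set_proj \<delta>0 X (curve_image q)) < \<epsilon>' l c"
    using contr unfolding contracting_set_def by blast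
  \<comment> \<open>Contraction is tested on geodesics only, which are quasigeodesics with constants
    1 and 0.\<close>
  define \<mu> \<epsilon> where "\<mu> = \<mu>' 1 0" and "\<epsilon> = \<epsilon>' 1 0"
  have nn: "0 \<le> \<mu>" "0 \<le> \<epsilon>" using me(1) by (simp_all add: \<mu>_def \<epsilon>_def)
  have contr': "bounded (set_proj \<delta>0 X (curve_image q)) \<and> diameter (set_proj \<delta>0 X (curve_image q)) < \<epsilon>"
    if "geodesic q" "\<mu> \<le> setdist (curve_image q) X" for q
    using me(2) that L quasigeodesic_geodesic[OF that(1)] unfolding preferred_collection_def \<mu>_def \<epsilon>_def by blast
  define \<pi> where "\<pi> y = (SOME x. x \<in> point_proj \<delta>0 X y)" for y
  have \<pi>: "\<pi> y \<in> point_proj \<delta>0 X y" for y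
    unfolding \<pi>_def using point_proj_nonempty[OF \<delta>0 X] by (simp add: some_in_eq)
  have \<pi>X: "\<pi> y \<in> X" and \<pi>d: "dist y (\<pi> y) \<le> infdist y X + \<delta>0" for y
    using \<pi>[of y] by (auto simp: point_proj_def)
  have far: "dist (\<pi> (p 0)) (\<pi> (p s)) \<le> \<epsilon>"
    if g: "geodesic ({0..r}, p)" and s: "0 \<le> s" "s \<le> r" and d: "\<And>t. t \<in> {0..s} \<Longrightarrow> \<mu> \<le> infdist (p t) X" for p r s
  proof -
    let ?q = "({0..s}, p)"
    have "\<mu> \<le> setdist (curve_image ?q) X"
    proof (rule le_setdistI)
      show "curve_image ?q \<noteq> {}" using s by (simp add: curve_image_def)
      fix a b assume "a \<in> curve_image ?q" "b \<in> X"
      then obtain t where "t \<in> {0..s}" "a = p t" by (auto simp: curve_image_def)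
      then show "\<mu> \<le> dist a b" using d[of t] infdist_le[OF \<open>b \<in> X\<close>, of a] by simp
    qed (rule X)
    then have b: "bounded (set_proj \<delta>0 X (curve_image ?q))" "diameter (set_proj \<delta>0 X (curve_image ?q)) < \<epsilon>"
      using contr'[OF geodesic_sub[OF g s]] by auto
    have "\<pi> (p t) \<in> set_proj \<delta>0 X (curve_image ?q)" if "t \<in> {0..s}" for t
      using \<pi>[of "p t"] that by (auto simp: set_proj_def curve_image_def)
    then have "dist (\<pi> (p 0)) (\<pi> (p s)) \<le> diameter (set_proj \<delta>0 X (curve_image ?q))"
      using s by (intro diameter_bounded_bound[OF b(1)]) auto
    then show ?thesis using b(2) by simp
  qed
  define \<kappa> where "\<kappa> = \<epsilon> + \<mu> + 2 + \<delta>0"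
  have near: "\<exists>s\<in>{0..t}. dist (p s) (\<pi> (p 0)) \<le> \<kappa>"
    if g: "geodesic ({0..r}, p)" and t: "t \<in> {0..r}" "infdist (p t) X < \<mu>" for p r t
  proof -
    define S where "S = {s \<in> {0..t}. infdist (p s) X < \<mu>}"
    have tS: "t \<in> S" using t by (simp add: S_def)
    have bdd: "bdd_below S" by (rule bdd_belowI[of _ 0]) (simp add: S_def)
    have I0: "0 \<le> Inf S" by (rule cInf_greatest) (use tS in \<open>auto simp: S_def\<close>)
    obtain s1 where s1: "s1 \<in> S" "s1 < Inf S + 1" using cInf_lessD[of S "Inf S + 1"] tS by auto
    have s1I: "Inf S \<le> s1" by (rule cInf_lower[OF s1(1) bdd])
    \<comment> \<open>Stepping back by 1 keeps the initial piece off \<open>S\<close> whether or not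
      the infimum is attained, and leaves \<open>s\<close> within 2 of \<open>s1\<close>, which is
      close to \<open>X\<close>. If \<open>Inf S \<le> 1\<close>, then \<open>s = 0\<close> and the
      projection has not moved.\<close>
    define s where "s = max 0 (Inf S - 1)"
    have s: "0 \<le> s" "s \<le> s1" "\<bar>s - s1\<bar> \<le> 2" "s1 \<le> t" using s1 s1I I0 by (auto simp: s_def S_def)
    have pd: "dist (p s) (p s1) \<le> 2" using geodesic_dist[OF g, of s s1] s t by auto
    have "infdist (p s) X \<le> infdist (p s1) X + dist (p s) (p s1)" by (rule infdist_triangle)
    then have inf: "infdist (p s) X < \<mu> + 2" using s1 pd by (simp add: S_def)
    have "dist (\<pi> (p 0)) (\<pi> (p s)) \<le> \<epsilon>"
    proof (cases "Inf S \<le> 1")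
      case True
      then show ?thesis using nn by (simp add: s_def)
    next
      case False
      show ?thesis
      proof (rule far[OF g])
        fix x assume x: "x \<in> {0..s}"
        show "\<mu> \<le> infdist (p x) X"
        proof (rule ccontr)
          assume "\<not> \<mu> \<le> infdist (p x) X"
          then have "x \<in> S" using x s by (simp add: S_def)
          then show False using cInf_lower[OF _ bdd, of x] x False by (simp add: s_def)
        qed
      qed (use s t in auto)
    qed
    then have "dist (p s) (\<pi> (p 0)) \<le> \<kappa>"
      using \<pi>d[of "p s"] inf dist_triangle[of "p s" "\<pi> (p 0)" "\<pi> (p s)"] by (simp add: \<kappa>_def dist_commute)
    then show ?thesis using s by auto
  qed
  define K where "K = 4 * \<kappa> + \<epsilon> + \<delta>0"
  have K: "\<epsilon> \<le> K" "4 * \<kappa> \<le> K" "\<delta>0 \<le> K" using nn \<delta>0 by (simp_all add: K_def \<kappa>_def)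
  have "dist y (\<pi> y) + dist (\<pi> y) (\<pi> z) + dist (\<pi> z) z \<le> dist y z + K"
    if kd: "K < dist (\<pi> y) (\<pi> z)" for y z
  proof -
    obtain p where p: "geodesic ({0..dist y z}, p)" "p 0 = y" "p (dist y z) = z"
      using gs unfolding geodesic_space_def by blast
    let ?r = "dist y z"
    have "\<exists>t\<in>{0..?r}. infdist (p t) X < \<mu>"
    proof (rule ccontr)
      assume "\<not> ?thesis"
      then have "dist (\<pi> (p 0)) (\<pi> (p ?r)) \<le> \<epsilon>" by (intro far[OF p(1)]) (auto simp: not_less)
      then show False using kd K p by simp
    qed
    then obtain t where t: "t \<in> {0..?r}" "infdist (p t) X < \<mu>" by blast
    \<comment> \<open>Cutting at \<open>t\<close> puts the points near the two projections in order,
      \<open>s \<le> t \<le> ?r - s'\<close>, so the three pieces add up to \<open>dist y z\<close>.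
      Each detour of size \<kappa> is counted twice, hence \<open>4 * \<kappa>\<close>.\<close>
    obtain s where s: "s \<in> {0..t}" "dist (p s) (\<pi> y) \<le> \<kappa>" using near[OF p(1) t] p(2) by blast
    obtain s' where s': "s' \<in> {0..?r - t}" "dist (p (?r - s')) (\<pi> z) \<le> \<kappa>"
      using near[OF geodesic_rev[OF p(1)], of "?r - t"] t p(3) by auto
    have "dist y (p s) = s" using geodesic_dist[OF p(1), of 0 s] s t p(2) by auto
    moreover have "dist (p s) (p (?r - s')) = ?r - s' - s"
      using geodesic_dist[OF p(1), of s "?r - s'"] s s' t by auto
    moreover have "dist (p (?r - s')) z = s'" using geodesic_dist[OF p(1), of "?r - s'" ?r] s' t p(3) by auto
    ultimately show ?thesis
      using s(2) s'(2) K(2) dist_triangle[of y "\<pi> y" "p s"] dist_triangle[of "\<pi> y" "\<pi> z" "p s"]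
        dist_triangle[of "p s" "\<pi> z" "p (?r - s')"] dist_triangle[of "\<pi> z" z "p (?r - s')"]
      by (simp add: dist_commute)
  qed
  moreover have "dist y (\<pi> y) \<le> dist y x + K" if "x \<in> X" for x y
    using \<pi>d[of y] infdist_le[OF that, of y] K by linarith
  ultimately show ?thesis using \<pi>X by blast
qed

text \<open>Translates of a bounded set cover the space, so every point of a geodesic is within
  \<open>R\<close> of the orbit of \<open>y0\<close>.\<close>

lemma cocompact_coarse_geodesic:
  fixes \<phi> :: "'a \<Rightarrow> 'b::metric_space \<Rightarrow> 'b"
  assumes gs: "geodesic_space TYPE('b)" and iso: "isometric_action G \<phi>" and cc: "cocompact_action G \<phi>"
  shows "\<exists>R. \<forall>y z t. 0 \<le> t \<longrightarrow> t \<le> dist y z \<longrightarrow>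
    (\<exists>c\<in>carrier G. dist y (\<phi> c y0) \<le> t + R \<and> dist (\<phi> c y0) z \<le> dist y z - t + R)"
proof -
  obtain Q where Q: "compact Q" "(\<Union>g\<in>carrier G. \<phi> g ` Q) = UNIV" using cc by (auto simp: cocompact_action_def)
  obtain R where R: "\<And>x. x \<in> Q \<Longrightarrow> dist y0 x \<le> R"
    using compact_imp_bounded[OF Q(1)] unfolding bounded_any_center[of Q y0] by blast
  have orb: "\<exists>c\<in>carrier G. dist x (\<phi> c y0) \<le> R" for x
  proof -
    have "x \<in> (\<Union>g\<in>carrier G. \<phi> g ` Q)" using Q(2) by simp
    then obtain g k where g: "g \<in> carrier G" "k \<in> Q" "x = \<phi> g k" by blast
    have "dist x (\<phi> g y0) = dist k y0" using iso g by (simp add: isometric_action_def)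
    then show ?thesis using R[OF g(2)] g(1) by (intro bexI[of _ g]) (simp_all add: dist_commute)
  qed
  have "\<exists>c\<in>carrier G. dist y (\<phi> c y0) \<le> t + R \<and> dist (\<phi> c y0) z \<le> dist y z - t + R"
    if t: "0 \<le> t" "t \<le> dist y z" for y z t
  proof -
    obtain p where p: "geodesic ({0..dist y z}, p)" "p 0 = y" "p (dist y z) = z"
      using gs unfolding geodesic_space_def by blast
    obtain c where c: "c \<in> carrier G" "dist (p t) (\<phi> c y0) \<le> R" using orb by blast
    have "dist y (p t) = t" "dist (p t) z = dist y z - t"
      using geodesic_dist[OF p(1), of 0 t] geodesic_dist[OF p(1), of t "dist y z"] t p by auto
    then show ?thesis
      using c dist_triangle[of y "\<phi> c y0" "p t"] dist_triangle[of "\<phi> c y0" z "p t"]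
      by (intro bexI[of _ c]) (auto simp: dist_commute)
  qed
  then show ?thesis by blast
qed

section \<open>Passing from the action to \<open>contracting_group\<close>\<close>

lemma (in group) int_pow_eq_one:
  assumes "h \<in> carrier G" "infinite (generate G {h})" "h [^] (i::int) = \<one>"
  shows "i = 0"
proof (rule ccontr)
  assume i: "i \<noteq> 0"
  have "generate G {h} \<subseteq> (\<lambda>j. h [^] j) ` {0..<\<bar>i\<bar>}"
  proof
    fix x assume "x \<in> generate G {h}"
    then obtain k :: int where k: "x = h [^] k" using generate_pow[OF assms(1)] by blast
    have a: "h [^] \<bar>i\<bar> = \<one>" using assms by (cases "0 \<le> i") (simp_all add: int_pow_neg)
    have "k = \<bar>i\<bar> * (k div \<bar>i\<bar>) + k mod \<bar>i\<bar>" by (rule mult_div_mod_eq[symmetric])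
    then have "h [^] k = h [^] (\<bar>i\<bar> * (k div \<bar>i\<bar>)) \<otimes> h [^] (k mod \<bar>i\<bar>)"
      using int_pow_mult[OF assms(1)] by metis
    also have "h [^] (\<bar>i\<bar> * (k div \<bar>i\<bar>)) = \<one>"
      using int_pow_pow[OF assms(1), of "\<bar>i\<bar>" "k div \<bar>i\<bar>"] a by simp
    finally have "x = h [^] (k mod \<bar>i\<bar>)" using k assms(1) by simp
    then show "x \<in> (\<lambda>j. h [^] j) ` {0..<\<bar>i\<bar>}" using i by auto
  qed
  then show False using assms(2) finite_subset by blast
qed

lemma contracting_group_of_action:
  fixes \<phi> :: "'a \<Rightarrow> 'b::metric_space \<Rightarrow> 'b"
  assumes \<delta>0: "0 < \<delta>0" and L: "preferred_collection L" and gs: "geodesic_space TYPE('b)"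
    and geo: "geometric_action G \<phi>" and h: "contracting_element \<delta>0 L G \<phi> h"
  shows "\<exists>pr K R. contracting_group G (\<lambda>g. \<phi> g y0) h pr K R"
proof -
  have iso: "isometric_action G \<phi>" and proper: "proper_action G \<phi>" and cc: "cocompact_action G \<phi>"
    using geo by (auto simp: geometric_action_def)
  interpret group_action G UNIV \<phi> using iso by (simp add: isometric_action_def)
  interpret group G using group_hom group_hom.axioms(1) by blast
  have dist_\<phi>: "dist (\<phi> g x) (\<phi> g y) = dist x y" if "g \<in> carrier G" for g x y
    using iso that by (simp add: isometric_action_def)
  have comp: "\<phi> (a \<otimes>\<^bsub>G\<^esub> b) x = \<phi> a (\<phi> b x)" if "a \<in> carrier G" "b \<in> carrier G" for a b x
    using composition_rule[of x a b] that by simp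
  have one: "\<phi> \<one>\<^bsub>G\<^esub> x = x" for x
    using id_eq_one by (metis UNIV_I restrict_apply')
  obtain y where y: "contracting_set \<delta>0 L (orbit (G\<lparr>carrier := generate G {h}\<rparr>) \<phi> y)"
    and hc: "h \<in> carrier G" and hinf: "infinite (generate G {h})"
    using h by (auto simp: contracting_element_def)
  define X where "X = range (\<lambda>i::int. \<phi> (h [^]\<^bsub>G\<^esub> i) y)"
  have "orbit (G\<lparr>carrier := generate G {h}\<rparr>) \<phi> y = X"
    unfolding orbit_def X_def using generate_pow[OF hc] by auto
  then obtain K \<pi> where \<pi>: "\<forall>x. \<pi> x \<in> X" "\<forall>z. \<forall>x\<in>X. dist z (\<pi> z) \<le> dist z x + K"
    "\<forall>x z. K < dist (\<pi> x) (\<pi> z) \<longrightarrow> dist x (\<pi> x) + dist (\<pi> x) (\<pi> z) + dist (\<pi> z) z \<le> dist x z + K"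
    using contracting_projection[OF \<delta>0 L gs, of X] y unfolding X_def by auto
  have "\<forall>x. \<exists>i::int. \<pi> x = \<phi> (h [^]\<^bsub>G\<^esub> i) y" using \<pi>(1) unfolding X_def by blast
  from choice[OF this] obtain idx :: "'b \<Rightarrow> int" where idx: "\<And>x. \<pi> x = \<phi> (h [^]\<^bsub>G\<^esub> idx x) y" by blast
  obtain R where R: "\<And>y z t. 0 \<le> t \<Longrightarrow> t \<le> dist y z \<Longrightarrow>
    \<exists>c\<in>carrier G. dist y (\<phi> c y0) \<le> t + R \<and> dist (\<phi> c y0) z \<le> dist y z - t + R"
    using cocompact_coarse_geodesic[OF gs iso cc, of y0] by blast
  define pr where "pr g = h [^]\<^bsub>G\<^esub> idx (\<phi> g y0)" for g
  have pr_dist: "dist (\<phi> (pr g) y0) (\<pi> (\<phi> g y0)) = dist y0 y" for g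
    unfolding idx pr_def using dist_\<phi> hc by simp
  \<comment> \<open>The contracting orbit is that of \<open>y\<close>, while distances are measured
    on the orbit of \<open>y0\<close>. Replacing projections by the corresponding translates of
    \<open>y0\<close> changes the contraction inequality by at most four times
    \<open>dist y0 y\<close>.\<close>
  have "contracting_group G (\<lambda>g. \<phi> g y0) h pr (K + 6 * dist y0 y) R"
  proof
    fix a b c assume "a \<in> carrier G" "b \<in> carrier G" "c \<in> carrier G"
    then show "dist (\<phi> (c \<otimes>\<^bsub>G\<^esub> a) y0) (\<phi> (c \<otimes>\<^bsub>G\<^esub> b) y0) = dist (\<phi> a y0) (\<phi> b y0)"
      by (simp add: comp dist_\<phi>)
  next
    fix r
    have "finite {g \<in> carrier G. dist y0 (\<phi> g y0) \<le> max r 0}"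
      using proper unfolding proper_action_def by (metis max.cobounded2)
    then show "finite {g \<in> carrier G. dist (\<phi> \<one>\<^bsub>G\<^esub> y0) (\<phi> g y0) \<le> r}"
      unfolding one by (rule rev_finite_subset) auto
  next
    fix a b t assume "0 \<le> t" "t \<le> dist (\<phi> a y0) (\<phi> b y0)"
    then show "\<exists>c\<in>carrier G. dist (\<phi> a y0) (\<phi> c y0) \<le> t + R \<and>
        dist (\<phi> c y0) (\<phi> b y0) \<le> dist (\<phi> a y0) (\<phi> b y0) - t + R" by (rule R)
  next
    fix i :: int assume "h [^]\<^bsub>G\<^esub> i = \<one>\<^bsub>G\<^esub>"
    then show "i = 0" by (rule int_pow_eq_one[OF hc hinf])
  next
    fix g assume "g \<in> carrier G"
    show "\<exists>i::int. pr g = h [^]\<^bsub>G\<^esub> i" by (auto simp: pr_def)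
    fix i :: int
    have "dist (\<phi> (h [^]\<^bsub>G\<^esub> i) y0) (\<phi> (h [^]\<^bsub>G\<^esub> i) y) = dist y0 y" using dist_\<phi> hc by simp
    moreover have "dist (\<phi> g y0) (\<pi> (\<phi> g y0)) \<le> dist (\<phi> g y0) (\<phi> (h [^]\<^bsub>G\<^esub> i) y) + K"
      using \<pi>(2) by (auto simp: X_def)
    ultimately show "dist (\<phi> g y0) (\<phi> (pr g) y0) \<le> dist (\<phi> g y0) (\<phi> (h [^]\<^bsub>G\<^esub> i) y0) + (K + 6 * dist y0 y)"
      using pr_dist[of g] dist_triangle[of "\<phi> g y0" "\<phi> (pr g) y0" "\<pi> (\<phi> g y0)"]
        dist_triangle[of "\<phi> g y0" "\<phi> (h [^]\<^bsub>G\<^esub> i) y" "\<phi> (h [^]\<^bsub>G\<^esub> i) y0"]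
        dist_commute[of "\<phi> (pr g) y0" "\<pi> (\<phi> g y0)"] zero_le_dist[of y0 y] by linarith
  next
    fix g k assume far: "K + 6 * dist y0 y < dist (\<phi> (pr g) y0) (\<phi> (pr k) y0)"
    let ?g = "\<phi> g y0" and ?k = "\<phi> k y0"
    let ?a = "\<phi> (pr g) y0" and ?b = "\<phi> (pr k) y0"
    have n: "0 \<le> dist y0 y" by simp
    have 1: "dist ?a ?b \<le> dist (\<pi> ?g) (\<pi> ?k) + 2 * dist y0 y"
      using pr_dist[of g] pr_dist[of k] dist_triangle[of ?a ?b "\<pi> ?g"] dist_triangle[of "\<pi> ?g" ?b "\<pi> ?k"]
        dist_commute[of ?b "\<pi> ?k"] by linarith
    have "K < dist (\<pi> ?g) (\<pi> ?k)" using far 1 n by linarith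
    then have "dist ?g (\<pi> ?g) + dist (\<pi> ?g) (\<pi> ?k) + dist (\<pi> ?k) ?k \<le> dist ?g ?k + K" using \<pi>(3) by blast
    then show "dist ?g ?a + dist ?a ?b + dist ?b ?k \<le> dist ?g ?k + (K + 6 * dist y0 y)"
      using 1 n pr_dist[of g] pr_dist[of k] dist_triangle[of ?g ?a "\<pi> ?g"] dist_triangle[of ?b ?k "\<pi> ?k"]
        dist_commute[of ?a "\<pi> ?g"] by linarith
  qed (rule hc)
  then show ?thesis by blast
qed

text \<open>A fibre of the orbit map is a translate of the stabilizer of the base point, which is
  finite because balls are finite.\<close>

lemma (in contracting_group) ball_card_le_orbit:
  "\<exists>c>0. \<forall>n. real (ball_card n) \<le> c * real (card (pt ` {g \<in> carrier G. d \<one> g \<le> real n}))"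
proof -
  let ?c = "card {g \<in> carrier G. d \<one> g \<le> 0}"
  have "ball_card n \<le> card (pt ` {g \<in> carrier G. d \<one> g \<le> real n}) * ?c" for n
  proof -
    let ?A = "{g \<in> carrier G. d \<one> g \<le> real n}"
    have fin: "finite (pt ` ?A)" using finite_ball by simp
    have "ball_card n \<le> card (\<Union>y\<in>pt ` ?A. {g \<in> ?A. pt g = y})"
      unfolding ball_card_def 
      by (rule card_mono[OF finite_subset[OF _ finite_ball[of "real n"]]]) auto
    also have "\<dots> \<le> (\<Sum>y\<in>pt ` ?A. card {g \<in> ?A. pt g = y})" by (rule card_UN_le[OF fin])
    also have "\<dots> \<le> of_nat (card (pt ` ?A)) * ?c"
    proof (rule sum_bounded_above)
      fix y assume "y \<in> pt ` ?A"
      then obtain a where a: "a \<in> carrier G" "y = pt a" by blast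
      have "card {g \<in> ?A. pt g = y} \<le> card {g \<in> carrier G. d a g \<le> 0}"
        by (intro card_mono finite_ball_at[OF a(1)]) (auto simp: a)
      also have "\<dots> \<le> ?c" by (rule card_ball_at[OF a(1)])
      finally show "card {g \<in> ?A. pt g = y} \<le> ?c" .
    qed
    finally show ?thesis by simp
  qed
  moreover have "0 < ?c"
    using finite_ball[of 0] by (auto simp: card_gt_0_iff intro!: exI[of _ \<one>])
  ultimately show ?thesis
    by (intro exI[of _ "real ?c"]) (simp add: mult.commute flip: of_nat_mult)
qed

theorem theorem1p3:
  fixes G :: "('a, 'm) monoid_scheme"
    and \<phi> :: "'a \<Rightarrow> 'b::metric_space \<Rightarrow> 'b"
    and L :: "'b curve set"
    and \<delta>0 :: real
    and y0 :: 'b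
  assumes "0 < \<delta>0"
    and "preferred_collection L"
    and "geodesic_space TYPE('b)"
    and "nonelementary_group G"
    and "geometric_action G \<phi>"
    and "\<exists>h. contracting_element \<delta>0 L G \<phi> h"
  shows "growth_tight G \<phi> y0"
proof -
  obtain h pr K R where cg: "contracting_group G (\<lambda>g. \<phi> g y0) h pr K R"
    using contracting_group_of_action[OF assms(1-3,5)] assms(6) by metis
  have iso: "isometric_action G \<phi>" using assms(5) by (simp add: geometric_action_def)
  interpret group_action G UNIV \<phi> using iso by (simp add: isometric_action_def)
  interpret contracting_group G "\<lambda>g. \<phi> g y0" h pr K R by (rule cg)
  have comp: "\<phi> (a \<otimes>\<^bsub>G\<^esub> b) x = \<phi> a (\<phi> b x)" if "a \<in> carrier G" "b \<in> carrier G" for a b x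
    using composition_rule[of x a b] that by simp
  have one: "\<phi> \<one>\<^bsub>G\<^esub> x = x" for x
    using id_eq_one by (metis UNIV_I restrict_apply')
  have ne: "\<not> elementary_group G" using assms(4) by (simp add: nonelementary_group_def)
  show ?thesis
    unfolding growth_tight_def
  proof (intro allI impI, elim conjE)
    fix \<Gamma> assume N: "\<Gamma> \<lhd> G" and inf: "infinite \<Gamma>"
    interpret N: normal \<Gamma> G by fact
    obtain s s' c where s: "0 \<le> s" "s < s'" and c: "\<And>n. real (coset_card \<Gamma> n) \<le> c * exp (s * real n)"
      and ball: "\<And>c. \<exists>n. c * exp (s' * real n) < real (ball_card n)"
      using coset_growth_gap[OF ne N inf] by blast
    obtain c0 where c0: "0 < c0" "\<And>n. real (ball_card n) \<le> c0 * real (card ((\<lambda>g. \<phi> g y0) ` {g \<in> carrier G. d \<one>\<^bsub>G\<^esub> g \<le> real n}))"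
      using ball_card_le_orbit by blast
    have orb: "orbit_ball G \<phi> dist y0 n \<inter> (\<lambda>g. \<phi> g y0) ` carrier G = (\<lambda>g. \<phi> g y0) ` {g \<in> carrier G. d \<one>\<^bsub>G\<^esub> g \<le> real n}" for n
      by (auto simp: orbit_ball_def one)
    have "ereal s' \<le> growth_rate G \<phi> dist y0 (carrier G)"
      unfolding growth_rate_def orb
    proof (rule limsup_ln_ge)
      fix b
      obtain n where "c0 * b * exp (s' * real n) < real (ball_card n)" using ball by blast
      also note c0(2)
      finally show "\<exists>n. b * exp (s' * real n) < real (card ((\<lambda>g. \<phi> g y0) ` {g \<in> carrier G. d \<one>\<^bsub>G\<^esub> g \<le> real n}))"
        using c0(1) by (intro exI[of _ n]) (simp add: mult.assoc)
    qed (use s in simp)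
    moreover have "growth_rate (G Mod \<Gamma>) (quotient_action \<phi>) setdist
        (orbit (G\<lparr>carrier := \<Gamma>\<rparr>) \<phi> y0) (carrier (G Mod \<Gamma>)) \<le> ereal s"
      unfolding growth_rate_def
    proof (rule limsup_ln_le[OF s(1)])
      fix n
      let ?o = "orbit (G\<lparr>carrier := \<Gamma>\<rparr>) \<phi> y0"
      let ?S = "{C \<in> rcosets\<^bsub>G\<^esub> \<Gamma>. d \<one>\<^bsub>G\<^esub> (coset_rep C) \<le> real n}"
      \<comment> \<open>The distance between two points of the two orbits is the length of an
        element of \<open>C\<close>, which is at least that of the shortest one.\<close>
      have short: "d \<one>\<^bsub>G\<^esub> (coset_rep C) \<le> setdist ?o (quotient_action \<phi> C ?o)" if C: "C \<in> rcosets\<^bsub>G\<^esub> \<Gamma>" for C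
      proof -
        define g where "g = coset_rep C"
        have g: "g \<in> carrier G" "C = \<Gamma> #>\<^bsub>G\<^esub> g" using coset_rep[OF N.subgroup_axioms C] by (auto simp: g_def)
        have q: "quotient_action \<phi> C ?o = orbit (G\<lparr>carrier := \<Gamma>\<rparr>) \<phi> (\<phi> g y0)"
          unfolding g(2) using quotient_action_orbit[OF group_action_axioms N g(1)] by simp
        have ne: "orbit (G\<lparr>carrier := \<Gamma>\<rparr>) \<phi> x \<noteq> {}" for x
          unfolding orbit_def using N.one_closed by (simp, blast)
        show ?thesis
          unfolding q
        proof (rule le_setdistI[OF ne ne])
          fix u v assume "u \<in> ?o" "v \<in> orbit (G\<lparr>carrier := \<Gamma>\<rparr>) \<phi> (\<phi> g y0)"
          then obtain a b where ab: "a \<in> \<Gamma>" "b \<in> \<Gamma>" "u = \<phi> a y0" "v = \<phi> b (\<phi> g y0)" by (auto simp: orbit_def)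
          then have c: "a \<in> carrier G" "b \<in> carrier G" using N.subset by auto
          have "(inv\<^bsub>G\<^esub> a \<otimes>\<^bsub>G\<^esub> b) \<otimes>\<^bsub>G\<^esub> g \<in> C" unfolding g(2) r_coset_def using ab by blast
          then have "d \<one>\<^bsub>G\<^esub> (coset_rep C) \<le> d \<one>\<^bsub>G\<^esub> ((inv\<^bsub>G\<^esub> a \<otimes>\<^bsub>G\<^esub> b) \<otimes>\<^bsub>G\<^esub> g)"
            by (rule coset_rep(2)[OF N.subgroup_axioms C])
          also have "\<dots> = d a (b \<otimes>\<^bsub>G\<^esub> g)"
            using d_inv[of "b \<otimes>\<^bsub>G\<^esub> g" "\<one>\<^bsub>G\<^esub>" a] c g by (simp add: m_assoc dist_commute)
          finally show "d \<one>\<^bsub>G\<^esub> (coset_rep C) \<le> dist u v" using ab c g by (simp add: comp)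
        qed
      qed
      \<comment> \<open>By \<open>short\<close>, each orbit in the ball is the translate of the base
        orbit by a coset with a short representative.\<close>
      have "card (orbit_ball (G Mod \<Gamma>) (quotient_action \<phi>) setdist ?o n \<inter>
          (\<lambda>g. quotient_action \<phi> g ?o) ` carrier (G Mod \<Gamma>)) \<le> card ((\<lambda>C. quotient_action \<phi> C ?o) ` ?S)"
        by (intro card_mono finite_imageI finite_short_cosets[OF N.subgroup_axioms])
          (use short in \<open>force simp: orbit_ball_def FactGroup_def\<close>)
      also have "\<dots> \<le> coset_card \<Gamma> n"
        unfolding coset_card_def by (intro card_image_le finite_short_cosets[OF N.subgroup_axioms])
      finally show "real (card (orbit_ball (G Mod \<Gamma>) (quotient_action \<phi>) setdist ?o n \<inter>
          (\<lambda>g. quotient_action \<phi> g ?o) ` carrier (G Mod \<Gamma>))) \<le> c * exp (s * real n)"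
        using c[of n] by linarith
    qed
    ultimately show "growth_rate (G Mod \<Gamma>) (quotient_action \<phi>) setdist
        (orbit (G\<lparr>carrier := \<Gamma>\<rparr>) \<phi> y0) (carrier (G Mod \<Gamma>)) < growth_rate G \<phi> dist y0 (carrier G)"
      using s(2) by (meson ereal_less(2) le_less_trans less_ereal.simps(1) less_le_trans)
  qed
qed

end
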